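(* For a given class $\mathscr C_\kappa[Z]$, the identity (a) $\mathbb E\{\kappa(B^{-h}\widetilde Z)\,F(\widetilde Z/\kappa(B^{-h}\widetilde Z)^{1/\alpha})\}=\mathbb E\{\kappa(B^{-h}Z)\,F(Z/\kappa(B^{-h}Z)^{1/\alpha})\}$ for all $F\in\mathcal H$ and all $h\in\mathcal T$ (which is the identity relating $Z$ and the members $\widetilde Z$ of the class) is equivalent with (b) $\mathbb E\{\kappa(B^{h}Z)F(Z)\}=\mathbb E\{\kappa(B^{h}\widetilde Z)F(\widetilde Z)\}$ for all $F\in\mathfrak H_0$, all $h\in\mathcal T$ and all $\widetilde Z\in\mathscr C_\kappa[Z]$, and (c) $\mathbb E\{F(Z)\}=\mathbb E\{F(\widetilde Z)\}$ for all $F\in\mathfrak H_\alpha$ and all $\widetilde Z\in\mathscr C_\kappa[Z]$.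
   Context: Setting. $d,l$ are positive integers, $\alpha>0$. $\mathcal T$ is either $\mathbb R^l$ or a non-empty subset of $\mathbb Z^l$; $\mathbb T_0$ is the set of points of $\mathcal T$ with rational coordinates. $\lambda$ is Lebesgue measure on $\mathbb R^l$, and counting measure when integrating over a countable set. $\mathrm D=\mathrm D(\mathcal T,\mathbb R^d)$ is the space of functions $f:\mathcal T\to\mathbb R^d$ with the product (cylindrical) $\sigma$-field. $B$ is the backshift, $(B^hf)(t)=f(t-h)$; for instance, if $\kappa(f)=\|f(0)\|^\alpha$ for a norm on $\mathbb R^d$, then $\kappa(B^{-t}f)=\|f(t)\|^\alpha$. $\mathcal H$ is the class of all measurable maps $F:\mathrm D\to E$ with $E=\mathbb R$ or $E=[0,\infty]$; $\mathcal H_\beta\subset\mathcal H$ ($\beta\ge0$) consists of the $\beta$-homogeneous ones, i.e. $F(cf)=c^\beta F(f)$ for all $c>0$, $f\in\mathrm D$. $\kappa:\mathrm D\to[0,\infty]$ is a fixed element of $\mathcal H_\alpha$. Suprema $\sup_{t\in A}\kappa(B^{t}f)$, $A\subset\mathcal T$, are taken over $A\cap\mathbb T_0$. Conventions: $\infty\cdot0$ and $0/0$ are interpreted as $0$. $\mathfrak W_\kappa$ is the class of $\mathbb R^d$-valued random fields $V(t),t\in\mathcal T$, defined on complete probability spaces, such that $\kappa(B^{-t}V),t\in\mathcal T$ is stochastically continuous and $\kappa(B^tV),t\in\mathcal T$ is jointly measurable and separable with separant $\mathbb T_0$. The class $\mathscr C_\kappa[Z]$ with representer $Z$ consists of $Z\in\mathfrak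 W_\kappa$ and all $\widetilde Z\in\mathfrak W_\kappa$ (possibly defined on other probability spaces; expectations are always denoted by $\mathbb E$) such that $$\mathbb P\{\sup_{t\in\mathcal T}\kappa(B^{-t}Z)>0\}=\mathbb P\{\sup_{t\in\mathcal T}\kappa(B^{-t}\widetilde Z)>0\}=1,\qquad \mathbb E\{\kappa(Z)\}\in(0,\infty),$$ $\mathbb E\{\sup_{t\in[-c,c]^l\cap\mathcal T}\kappa(B^{-t}Z)\}<\infty$ for all $c\in(0,\infty)$, likewise for $\widetilde Z$, and such that identity (a) of the claim holds for $Z$ and $\widetilde Z$. $\mathfrak G$ is the class of $\lambda$-measurable locally bounded $g:\mathcal T\to[0,\infty)$, almost everywhere positive when $\mathcal T=\mathbb R^l$. $\mathfrak H_\beta$ ($\beta\ge0$) is the class of $\beta$-homogeneous maps of the form $$F(f)=\frac{\Gamma(f)\,I_1(f)\,\mathbb I(I_2(f)\in A)}{I_3(f)},\qquad I_i(f)=\int_{\mathcal T}\kappa(B^{-t}f)^{\xi_i}g_i(t)\,\lambda(dt),$$ with $\Gamma\in\mathcal H_{\xi_0}$, $g_i\in\mathfrak G$ for $i\le3$, constants $\xi_i$, and $A\subset[0,\infty]$ such that $F$ is $\beta$-homogeneous; $F(f)=0$ if the expression is undefined.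
   Formalization: When the index set is a non-empty subset of Z^l, it is additionally required to be closed under differences, since otherwise the backshift (B^h f)(t)=f(t-h) is not defined for all t, h in the index set. *)

theory Defs
  imports "HOL-Probability.Probability"
begin

type_synonym ('l, 'd) path = "real ^ 'l \<Rightarrow> real ^ 'd"

text \<open>Since \<open>(B\<^sup>h f)(t) = f (t - h)\<close> has to be defined for all \<open>t, h \<in> T\<close>, a discrete index set
  must be closed under differences.\<close>

definition index_set :: "(real ^ 'l) set \<Rightarrow> bool" where
  "index_set T \<longleftrightarrow> T = UNIV \<or>
     (T \<noteq> {} \<and> (\<forall>t\<in>T. \<forall>i. t $ i \<in> \<int>) \<and> (\<forall>t\<in>T. \<forall>h\<in>T. t - h \<in> T))"

definition rational_points :: "(real ^ 'l) set \<Rightarrow> (real ^ 'l) set" where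
  "rational_points T = {t \<in> T. \<forall>i. t $ i \<in> \<rat>}"

definition index_measure :: "(real ^ 'l) set \<Rightarrow> (real ^ 'l) measure" where
  "index_measure T = (if T = UNIV then lebesgue else count_space T)"

definition path_space :: "(real ^ 'l) set \<Rightarrow> ('l, 'd::finite) path measure" where
  "path_space T = (\<Pi>\<^sub>M t\<in>T. borel)"

definition backshift :: "(real ^ 'l) set \<Rightarrow> real ^ 'l \<Rightarrow> ('l, 'd::finite) path \<Rightarrow> ('l, 'd::finite) path" where
  "backshift T h f = (\<lambda>t\<in>T. f (t - h))"

definition scale_path :: "(real ^ 'l) set \<Rightarrow> real \<Rightarrow> ('l, 'd::finite) path \<Rightarrow> ('l, 'd::finite) path" where
  "scale_path T c f = (\<lambda>t\<in>T. c *\<^sub>R f t)"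

text \<open>\<open>f / k powr (1/\<alpha>)\<close>, which is the zero path for \<open>k = \<infinity>\<close>. The junk value (also the zero path)
  for \<open>k = 0\<close> is irrelevant: it is only used inside a product with first factor \<open>k\<close>.\<close>

definition normalize_path :: "(real ^ 'l) set \<Rightarrow> real \<Rightarrow> ennreal \<Rightarrow> ('l, 'd::finite) path \<Rightarrow> ('l, 'd::finite) path" where
  "normalize_path T \<alpha> k f = scale_path T (inverse (enn2real k powr (1 / \<alpha>))) f"

text \<open>Maps into \<open>\<real>\<close> and maps into \<open>[0,\<infinity>]\<close> are both represented as \<^typ>\<open>ereal\<close>-valued functions.
  In \<^typ>\<open>ereal\<close>, \<open>\<infinity> * 0 = 0\<close>.\<close>

definition meas_maps :: "(real ^ 'l) set \<Rightarrow> (('l, 'd::finite) path \<Rightarrow> ereal) set" where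
  "meas_maps T = {F \<in> borel_measurable (path_space T).
     (\<forall>f\<in>space (path_space T). \<bar>F f\<bar> \<noteq> \<infinity>) \<or> (\<forall>f\<in>space (path_space T). 0 \<le> F f)}"

definition homogeneous :: "(real ^ 'l) set \<Rightarrow> real \<Rightarrow> (('l, 'd::finite) path \<Rightarrow> ereal) \<Rightarrow> bool" where
  "homogeneous T \<beta> F \<longleftrightarrow>
     (\<forall>c>0. \<forall>f\<in>space (path_space T). F (scale_path T c f) = ereal (c powr \<beta>) * F f)"

definition hom_maps :: "(real ^ 'l) set \<Rightarrow> real \<Rightarrow> (('l, 'd::finite) path \<Rightarrow> ereal) set" where
  "hom_maps T \<beta> = {F \<in> meas_maps T. homogeneous T \<beta> F}"

text \<open>Stochastic continuity of a \<open>[0,\<infinity>]\<close>-valued field: \<open>\<bar>X s - X t\<bar> \<le> \<epsilon>\<close> is written without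
  subtraction, so that two infinite values are at distance \<open>0\<close>.\<close>

definition stoch_continuous ::
  "(real ^ 'l) set \<Rightarrow> 'w measure \<Rightarrow> (real ^ 'l \<Rightarrow> 'w \<Rightarrow> ennreal) \<Rightarrow> bool" where
  "stoch_continuous T M X \<longleftrightarrow> (\<forall>t\<in>T. \<forall>\<epsilon>>0.
     ((\<lambda>s. measure M {\<omega> \<in> space M.
         \<not> (X s \<omega> \<le> X t \<omega> + ennreal \<epsilon> \<and> X t \<omega> \<le> X s \<omega> + ennreal \<epsilon>)}) \<longlongrightarrow> 0) (at t within T))"

definition separable_field ::
  "(real ^ 'l) set \<Rightarrow> (real ^ 'l) set \<Rightarrow> 'w measure \<Rightarrow> (real ^ 'l \<Rightarrow> 'w \<Rightarrow> ennreal) \<Rightarrow> bool" where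
  "separable_field T S M X \<longleftrightarrow> (AE \<omega> in M. \<forall>t\<in>T. \<exists>s :: nat \<Rightarrow> real ^ 'l.
     (\<forall>n. s n \<in> S) \<and> s \<longlonglongrightarrow> t \<and> (\<lambda>n. X (s n) \<omega>) \<longlonglongrightarrow> X t \<omega>)"

definition random_fields ::
  "(real ^ 'l) set \<Rightarrow> (('l, 'd::finite) path \<Rightarrow> ennreal) \<Rightarrow> 'w measure \<Rightarrow> ('w \<Rightarrow> ('l, 'd::finite) path) set" where
  "random_fields T \<kappa> M = {V.
     prob_space M \<and> complete_measure M \<and> V \<in> M \<rightarrow>\<^sub>M path_space T \<and>
     stoch_continuous T M (\<lambda>t \<omega>. \<kappa> (backshift T (- t) (V \<omega>))) \<and>
     (\<lambda>(t, \<omega>). \<kappa> (backshift T t (V \<omega>))) \<in> borel_measurable (restrict_space borel T \<Otimes>\<^sub>M M) \<and>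
     separable_field T (rational_points T) M (\<lambda>t \<omega>. \<kappa> (backshift T t (V \<omega>)))}"

text \<open>The requirements that membership in the class with a given representer imposes on the
  representer and on each member individually, i.e. all of them except the identity relating
  the two.\<close>

definition admissible ::
  "(real ^ 'l) set \<Rightarrow> (('l, 'd::finite) path \<Rightarrow> ennreal) \<Rightarrow> 'w measure \<Rightarrow> ('w \<Rightarrow> ('l, 'd::finite) path) \<Rightarrow> bool" where
  "admissible T \<kappa> M V \<longleftrightarrow>
     V \<in> random_fields T \<kappa> M \<and>
     measure M {\<omega> \<in> space M. (SUP t\<in>rational_points T. \<kappa> (backshift T (- t) (V \<omega>))) > 0} = 1 \<and>
     0 < (\<integral>\<^sup>+\<omega>. \<kappa> (V \<omega>) \<partial>M) \<and> (\<integral>\<^sup>+\<omega>. \<kappa> (V \<omega>) \<partial>M) < \<infinity> \<and>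
     (\<forall>c>0. (\<integral>\<^sup>+\<omega>. (SUP t\<in>{t \<in> rational_points T. \<forall>i. \<bar>t $ i\<bar> \<le> c}.
               \<kappa> (backshift T (- t) (V \<omega>))) \<partial>M) < \<infinity>)"

definition weights :: "(real ^ 'l) set \<Rightarrow> (real ^ 'l \<Rightarrow> real) set" where
  "weights T = {g \<in> borel_measurable (index_measure T).
     (\<forall>t\<in>T. 0 \<le> g t) \<and>
     (\<forall>t\<in>T. \<exists>U. open U \<and> t \<in> U \<and> bounded (g ` (U \<inter> T))) \<and>
     (T = UNIV \<longrightarrow> (AE t in lebesgue. 0 < g t))}"

text \<open>Powers of extended nonnegative reals with \<open>x\<^sup>0 = 1\<close> for all \<open>x\<close> and, for negative exponents,
  \<open>0 \<mapsto> \<infinity>\<close> and \<open>\<infinity> \<mapsto> 0\<close>.\<close>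

definition epow :: "ennreal \<Rightarrow> real \<Rightarrow> ennreal" where
  "epow x \<xi> =
     (if \<xi> = 0 then 1
      else if x = 0 then (if \<xi> > 0 then 0 else \<infinity>)
      else if x = \<infinity> then (if \<xi> > 0 then \<infinity> else 0)
      else ennreal (enn2real x powr \<xi>))"

definition kappa_integrand ::
  "(real ^ 'l) set \<Rightarrow> (('l, 'd::finite) path \<Rightarrow> ennreal) \<Rightarrow> real \<Rightarrow> (real ^ 'l \<Rightarrow> real) \<Rightarrow>
     ('l, 'd::finite) path \<Rightarrow> real ^ 'l \<Rightarrow> ennreal" where
  "kappa_integrand T \<kappa> \<xi> g f t = epow (\<kappa> (backshift T (- t) f)) \<xi> * ennreal (g t)"

definition kappa_integral ::
  "(real ^ 'l) set \<Rightarrow> (('l, 'd::finite) path \<Rightarrow> ennreal) \<Rightarrow> real \<Rightarrow> (real ^ 'l \<Rightarrow> real) \<Rightarrow>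
     ('l, 'd::finite) path \<Rightarrow> ennreal" where
  "kappa_integral T \<kappa> \<xi> g f = (\<integral>\<^sup>+t. kappa_integrand T \<kappa> \<xi> g f t \<partial>index_measure T)"

text \<open>The value is \<open>0\<close> where the expression is undefined, that is, if an integrand is not measurable
  or if the denominator vanishes; in \<^typ>\<open>ereal\<close>, \<open>\<infinity> / \<infinity> = 0\<close> holds already.\<close>

definition kappa_quotient ::
  "(real ^ 'l) set \<Rightarrow> (('l, 'd::finite) path \<Rightarrow> ennreal) \<Rightarrow> (('l, 'd::finite) path \<Rightarrow> ereal) \<Rightarrow>
     (nat \<Rightarrow> real) \<Rightarrow> (nat \<Rightarrow> real ^ 'l \<Rightarrow> real) \<Rightarrow> ennreal set \<Rightarrow> ('l, 'd::finite) path \<Rightarrow> ereal" where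
  "kappa_quotient T \<kappa> \<Gamma> \<xi> g A f =
     (if (\<forall>i\<in>{1..3}. kappa_integrand T \<kappa> (\<xi> i) (g i) f \<in> borel_measurable (index_measure T)) \<and>
         kappa_integral T \<kappa> (\<xi> 3) (g 3) f \<noteq> 0
      then \<Gamma> f * enn2ereal (kappa_integral T \<kappa> (\<xi> 1) (g 1) f) *
           indicator A (kappa_integral T \<kappa> (\<xi> 2) (g 2) f) /
           enn2ereal (kappa_integral T \<kappa> (\<xi> 3) (g 3) f)
      else 0)"

text \<open>These maps need not be measurable with respect to the product \<open>\<sigma>\<close>-field when \<open>T\<close> is
  uncountable.\<close>

definition integral_maps ::
  "(real ^ 'l) set \<Rightarrow> (('l, 'd::finite) path \<Rightarrow> ennreal) \<Rightarrow> real \<Rightarrow> (('l, 'd::finite) path \<Rightarrow> ereal) set" where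
  "integral_maps T \<kappa> \<beta> = {F. homogeneous T \<beta> F \<and>
     (\<exists>\<Gamma> \<xi> g A. 0 \<le> \<xi> 0 \<and> \<Gamma> \<in> hom_maps T (\<xi> 0) \<and> (\<forall>i\<in>{1..3}. g i \<in> weights T) \<and>
        (\<forall>f\<in>space (path_space T). F f = kappa_quotient T \<kappa> \<Gamma> \<xi> g A f))}"

definition has_expectation :: "'w measure \<Rightarrow> ('w \<Rightarrow> ereal) \<Rightarrow> ereal \<Rightarrow> bool" where
  "has_expectation M X v \<longleftrightarrow>
     X \<in> borel_measurable M \<and>
     ((\<integral>\<^sup>+\<omega>. e2ennreal (X \<omega>) \<partial>M) < \<infinity> \<or> (\<integral>\<^sup>+\<omega>. e2ennreal (- X \<omega>) \<partial>M) < \<infinity>) \<and>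
     v = enn2ereal (\<integral>\<^sup>+\<omega>. e2ennreal (X \<omega>) \<partial>M) - enn2ereal (\<integral>\<^sup>+\<omega>. e2ennreal (- X \<omega>) \<partial>M)"

text \<open>Equality of expectations: if one side exists in \<open>[-\<infinity>,\<infinity>]\<close>, then so does the other, with the
  same value. Expectations of \<open>[0,\<infinity>]\<close>-valued random variables always exist.\<close>

definition same_expectation ::
  "'w measure \<Rightarrow> ('w \<Rightarrow> ereal) \<Rightarrow> 'v measure \<Rightarrow> ('v \<Rightarrow> ereal) \<Rightarrow> bool" where
  "same_expectation M X N Y \<longleftrightarrow> (\<forall>v. has_expectation M X v \<longleftrightarrow> has_expectation N Y v)"

definition class_identity ::
  "(real ^ 'l) set \<Rightarrow> real \<Rightarrow> (('l, 'd::finite) path \<Rightarrow> ennreal) \<Rightarrow>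
     'w measure \<Rightarrow> ('w \<Rightarrow> ('l, 'd) path) \<Rightarrow> 'v measure \<Rightarrow> ('v \<Rightarrow> ('l, 'd) path) \<Rightarrow> bool" where
  "class_identity T \<alpha> \<kappa> M Z N Z' \<longleftrightarrow> (\<forall>F\<in>meas_maps T. \<forall>h\<in>T.
     same_expectation
       N (\<lambda>\<omega>. let k = \<kappa> (backshift T (- h) (Z' \<omega>)) in
             enn2ereal k * F (normalize_path T \<alpha> k (Z' \<omega>)))
       M (\<lambda>\<omega>. let k = \<kappa> (backshift T (- h) (Z \<omega>)) in
             enn2ereal k * F (normalize_path T \<alpha> k (Z \<omega>))))"

end

theory Submission
  imports Defs
begin

text \<open>
  Write \<open>k\<^sub>h f\<close> for \<open>\<kappa> (B\<^sup>h f)\<close>. The class identity says that for every \<open>h\<close> the normalised path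
  \<open>Z / k\<^sub>-\<^sub>h Z powr (1/\<alpha>)\<close> has, under the measure with density \<open>k\<^sub>-\<^sub>h Z\<close>, the same law as the
  normalised path of \<open>Z'\<close>. The other two statements are this assertion in homogeneous coordinates.

  \<^item> \<^emph>\<open>From homogeneous maps to the class identity.\<close> A map \<open>F\<close> of the normalised path extends to
  a \<open>0\<close>-homogeneous measurable map \<open>\<Gamma>\<close> with \<open>k\<^sub>-\<^sub>h Z * F (Z / k\<^sub>-\<^sub>h Z powr (1/\<alpha>)) = k\<^sub>-\<^sub>h Z * \<Gamma> Z\<close> almost
  surely, and \<open>k\<^sub>-\<^sub>h * \<Gamma>\<close> is \<open>\<alpha>\<close>-homogeneous. Measurable homogeneous maps are quotients of the
  required form whose path integrals are constants (\<open>hom_maps_subset_integral_maps\<close>).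

  \<^item> \<^emph>\<open>From the class identity to homogeneous maps.\<close> Let \<open>H\<close> be \<open>\<alpha>\<close>-homogeneous. Almost surely
  \<open>k\<^sub>-\<^sub>t Z\<close> is positive for some rational \<open>t\<close>, and the first such \<open>t\<close> in an enumeration \<open>q\<close> does not
  change when \<open>Z\<close> is scaled. On the event that it is \<open>q j\<close>, with \<open>x\<close> the value of \<open>k\<^sub>-\<^sub>t Z\<close> at \<open>t = q j\<close>,
  homogeneity gives \<open>H Z = x * H (Z / x powr (1/\<alpha>))\<close>. Summation over \<open>j\<close>
  expresses the expectation of \<open>H Z\<close> by expectations covered by the class identity
  (\<open>homogeneous_nn_integral_decomposition\<close>).

  This second argument needs \<open>H\<close> to be measurable for the product \<open>\<sigma>\<close>-field, whereas path integrals
  over \<open>\<real>\<^sup>l\<close> depend on uncountably many coordinates. Stochastic continuity closes the gap.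
  Evaluating the trace \<open>t \<mapsto> k\<^sub>-\<^sub>t f\<close> at finitely valued approximations \<open>r n t\<close> of \<open>t\<close> gives jointly
  measurable fields that converge in measure and, along a sequence common to \<open>Z\<close> and \<open>Z'\<close>, almost everywhere
  to the traces of both fields (\<open>exists_common_sampling\<close>). The paths with this convergence form a scale-invariant set, on which the path
  integrals coincide with product measurable functionals (\<open>kappa_integral_measurable_version\<close>). The set \<open>A\<close> in
  the indicator may moreover be assumed to be Borel, because homogeneity leaves no other choice that
  matters (\<open>quotient_borel_restriction\<close>).
\<close>

section \<open>Equality of expectations\<close>

lemma same_expectation_sym: "same_expectation M X N Y \<Longrightarrow> same_expectation N Y M X"
  by (auto simp: same_expectation_def)

lemma same_expectationI:
  assumes "X \<in> borel_measurable M" "Y \<in> borel_measurable N"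
    and "(\<integral>\<^sup>+\<omega>. e2ennreal (X \<omega>) \<partial>M) = (\<integral>\<^sup>+\<omega>. e2ennreal (Y \<omega>) \<partial>N)"
    and "(\<integral>\<^sup>+\<omega>. e2ennreal (- X \<omega>) \<partial>M) = (\<integral>\<^sup>+\<omega>. e2ennreal (- Y \<omega>) \<partial>N)"
  shows "same_expectation M X N Y"
  using assms by (simp add: same_expectation_def has_expectation_def)

lemma has_expectation_cong_AE:
  assumes "X \<in> borel_measurable M" "X' \<in> borel_measurable M" "AE \<omega> in M. X \<omega> = X' \<omega>"
  shows "has_expectation M X v \<longleftrightarrow> has_expectation M X' v"
proof -
  have "(\<integral>\<^sup>+\<omega>. e2ennreal (X \<omega>) \<partial>M) = (\<integral>\<^sup>+\<omega>. e2ennreal (X' \<omega>) \<partial>M)"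
    "(\<integral>\<^sup>+\<omega>. e2ennreal (- X \<omega>) \<partial>M) = (\<integral>\<^sup>+\<omega>. e2ennreal (- X' \<omega>) \<partial>M)"
    using assms(3) by (auto intro!: nn_integral_cong_AE)
  then show ?thesis using assms(1,2) by (simp add: has_expectation_def)
qed

lemma same_expectation_cong_AE:
  assumes "X \<in> borel_measurable M" "X' \<in> borel_measurable M" "AE \<omega> in M. X \<omega> = X' \<omega>"
    and "Y \<in> borel_measurable N" "Y' \<in> borel_measurable N" "AE \<omega> in N. Y \<omega> = Y' \<omega>"
    and "same_expectation M X N Y"
  shows "same_expectation M X' N Y'"
  using assms has_expectation_cong_AE[OF assms(1-3)] has_expectation_cong_AE[OF assms(4-6)]
  by (simp add: same_expectation_def)

lemma same_expectation_nonneg: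
  assumes "u \<in> borel_measurable M" "v \<in> borel_measurable N"
    and same: "same_expectation M (\<lambda>\<omega>. enn2ereal (u \<omega>)) N (\<lambda>\<omega>. enn2ereal (v \<omega>))"
  shows "(\<integral>\<^sup>+\<omega>. u \<omega> \<partial>M) = (\<integral>\<^sup>+\<omega>. v \<omega> \<partial>N)"
proof -
  have neg: "e2ennreal (- enn2ereal x) = 0" for x
    by (simp add: e2ennreal_neg)
  have "has_expectation M (\<lambda>\<omega>. enn2ereal (u \<omega>)) (enn2ereal (\<integral>\<^sup>+\<omega>. u \<omega> \<partial>M))"
    using assms(1) by (simp add: has_expectation_def neg zero_ennreal.rep_eq)
  with same have "has_expectation N (\<lambda>\<omega>. enn2ereal (v \<omega>)) (enn2ereal (\<integral>\<^sup>+\<omega>. u \<omega> \<partial>M))"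
    by (simp add: same_expectation_def)
  then show ?thesis
    by (simp add: has_expectation_def neg enn2ereal_inject zero_ennreal.rep_eq)
qed

text \<open>Scaling by a nonnegative factor commutes with taking the positive part, so that the positive
  and the negative part of a homogeneous map are homogeneous of the same degree.\<close>

lemma e2ennreal_mult_left: "e2ennreal (enn2ereal k * x) = k * e2ennreal x"
proof (cases "0 \<le> x")
  case True
  then obtain y where "x = enn2ereal y"
    by (metis enn2ereal_e2ennreal)
  then show ?thesis
    by (simp flip: times_ennreal.rep_eq)
next
  case False
  then have "enn2ereal k * x \<le> 0"
    by (simp add: ereal_mult_le_0_iff)
  with False show ?thesis by (simp add: e2ennreal_neg)
qed

lemma (in complete_measure) measurable_AE_eq:
  assumes "X \<in> M \<rightarrow>\<^sub>M borel" "AE \<omega> in M. X \<omega> = X' \<omega>"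
  shows "X' \<in> M \<rightarrow>\<^sub>M borel"
proof (rule measurableI)
  fix B :: "'b set" assume B: "B \<in> sets borel"
  show "X' -` B \<inter> space M \<in> sets M"
  proof (rule in_sets_AE)
    show "AE x in M. x \<in> X -` B \<inter> space M \<longleftrightarrow> x \<in> X' -` B \<inter> space M"
      using assms(2) by eventually_elim auto
  qed (use assms(1) B in auto)
qed simp

section \<open>Index sets\<close>

lemma countable_rational_points: "countable (rational_points T)"
proof (rule countable_subset)
  show "rational_points T \<subseteq> {t. \<forall>i. t $ i \<in> \<rat>}"
    by (auto simp: rational_points_def)
  show "countable {t :: real ^ 'a. \<forall>i. t $ i \<in> \<rat>}"
    by (rule countable_vector) (simp add: countable_rat)
qed

lemma index_set_diff: "index_set T \<Longrightarrow> s \<in> T \<Longrightarrow> t \<in> T \<Longrightarrow> s - t \<in> T"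
  by (auto simp: index_set_def)

lemma index_set_zero:
  assumes "index_set T"
  shows "0 \<in> T"
proof -
  obtain t where "t \<in> T" using assms by (auto simp: index_set_def)
  with index_set_diff[OF assms this this] show ?thesis by simp
qed

lemma index_set_uminus: "index_set T \<Longrightarrow> t \<in> T \<Longrightarrow> - t \<in> T"
  using index_set_diff[of T 0 t] by (simp add: index_set_zero)

lemma discrete_index_set_rational: "index_set T \<Longrightarrow> T \<noteq> UNIV \<Longrightarrow> rational_points T = T"
  unfolding index_set_def rational_points_def using Ints_subset_Rats by blast

text \<open>Tonelli's theorem and joint measurability are wanted for Borel functions of \<open>t\<close>, so the
  completion in \<^const>\<open>index_measure\<close> is undone here. Integrals and null sets do not change.\<close>

definition base_measure :: "(real ^ 'l) set \<Rightarrow> (real ^ 'l) measure" where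
  "base_measure T = (if T = UNIV then lborel else count_space T)"

lemma space_base_measure: "space (base_measure T) = T"
  by (simp add: base_measure_def)

lemma sigma_finite_base_measure: "index_set T \<Longrightarrow> sigma_finite_measure (base_measure T)"
  using countable_rational_points[of T] discrete_index_set_rational[of T]
  by (cases "T = UNIV") (simp_all add: base_measure_def lborel.sigma_finite_measure_axioms
      sigma_finite_measure_count_space_countable)

lemma nn_integral_index_measure:
  "(\<integral>\<^sup>+t. f t \<partial>index_measure T) = (\<integral>\<^sup>+t. f t \<partial>base_measure T)"
  by (simp add: index_measure_def base_measure_def nn_integral_completion)

lemma measurable_index_measure:
  "f \<in> base_measure T \<rightarrow>\<^sub>M K \<Longrightarrow> f \<in> index_measure T \<rightarrow>\<^sub>M K"
  by (auto simp: index_measure_def base_measure_def measurable_completion split: if_splits)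

lemma measurable_index_measure_version:
  fixes g :: "real ^ 'l \<Rightarrow> real"
  assumes "g \<in> borel_measurable (index_measure T)"
  obtains g' where "g' \<in> borel_measurable (base_measure T)" "AE t in base_measure T. g t = g' t"
proof (cases "T = UNIV")
  case True
  then have eq: "index_measure T = lebesgue" "base_measure T = lborel"
    by (simp_all add: index_measure_def base_measure_def)
  show ?thesis
    using completion_ex_borel_measurable_real[of g lborel] that assms unfolding eq by blast
next
  case False
  then have "g \<in> borel_measurable (base_measure T)"
    by (simp add: base_measure_def)
  then show ?thesis by (rule that) simp
qed

text \<open>Such a weight serves two purposes: with exponents \<open>0\<close> it makes the path integrals finite
  nonzero constants, and as a density it turns Lebesgue measure into an equivalent finite measure.\<close>

lemma integrable_positive_weight:
  assumes "index_set T"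
  obtains g where "g \<in> weights T" "g \<in> borel_measurable (base_measure T)" "\<And>t. 0 < g t"
    "0 < (\<integral>\<^sup>+t. ennreal (g t) \<partial>base_measure T)" "(\<integral>\<^sup>+t. ennreal (g t) \<partial>base_measure T) < \<infinity>"
proof -
  interpret sigma_finite_measure "base_measure T"
    by (rule sigma_finite_base_measure) fact
  obtain g :: "real ^ 'a \<Rightarrow> real" where g: "g \<in> borel_measurable (base_measure T)"
    "\<And>t. 0 < g t" "\<And>t. g t \<le> 1" "integrable (base_measure T) g"
    by (rule obtain_positive_integrable_function) blast
  have "bounded (g ` A)" for A
    by (rule boundedI[of _ 1]) (use g(3) in \<open>auto simp: abs_of_pos[OF g(2)]\<close>)
  then have "\<exists>U. open U \<and> t \<in> U \<and> bounded (g ` (U \<inter> T))" for t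
    by (intro exI[of _ UNIV]) simp
  then have "g \<in> weights T"
    using measurable_index_measure[OF g(1)] by (simp add: weights_def less_imp_le[OF g(2)] g(2))
  moreover have "(\<integral>\<^sup>+t. ennreal (g t) \<partial>base_measure T) < \<infinity>"
    using integrableD(2)[OF g(4)] by (simp add: less_imp_le[OF g(2)] top.not_eq_extremum)
  moreover have "(\<integral>\<^sup>+t. ennreal (g t) \<partial>base_measure T) \<noteq> 0"
  proof
    assume "(\<integral>\<^sup>+t. ennreal (g t) \<partial>base_measure T) = 0"
    then have "AE t in base_measure T. ennreal (g t) = 0"
      using g(1) by (subst (asm) nn_integral_0_iff_AE) auto
    then have "AE t in base_measure T. False"
    proof eventually_elim
      fix t assume "ennreal (g t) = 0"
      with g(2)[of t] show False by simp
    qed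
    then have "emeasure (base_measure T) T = 0"
      by (simp flip: trivial_limit_def add: ae_filter_eq_bot_iff space_base_measure)
    moreover have "emeasure (base_measure T) T \<noteq> 0"
    proof (cases "T = UNIV")
      case False
      with index_set_zero[OF assms] show ?thesis
        unfolding base_measure_def by (auto simp: emeasure_count_space_eq_0)
    qed (simp add: base_measure_def)
    ultimately show False by simp
  qed
  ultimately show ?thesis
    using that[of g] g(1,2) by (metis not_gr_zero)
qed

section \<open>Paths, shifts and scalings\<close>

lemma scale_path_in_space: "scale_path T c f \<in> space (path_space T)"
  by (simp add: scale_path_def path_space_def space_PiM)

lemma backshift_in_space: "backshift T h f \<in> space (path_space T)"
  by (simp add: backshift_def path_space_def space_PiM)

lemma scale_path_scale_path: "scale_path T b (scale_path T c f) = scale_path T (b * c) f"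
  by (auto simp: scale_path_def)

lemma backshift_scale_path:
  assumes "index_set T" "h \<in> T"
  shows "backshift T h (scale_path T c f) = scale_path T c (backshift T h f)"
proof
  fix t
  show "backshift T h (scale_path T c f) t = scale_path T c (backshift T h f) t"
    using index_set_diff[OF assms(1) _ assms(2), of t]
    by (cases "t \<in> T") (simp_all add: backshift_def scale_path_def)
qed

lemma measurable_coordinate: "t \<in> T \<Longrightarrow> (\<lambda>f. f t) \<in> borel_measurable (path_space T)"
  by (simp add: path_space_def)

lemma measurable_backshift:
  assumes "index_set T" "h \<in> T"
  shows "backshift T h \<in> path_space T \<rightarrow>\<^sub>M path_space T"
proof -
  have "(\<lambda>f. \<lambda>t\<in>T. f (t - h)) \<in> path_space T \<rightarrow>\<^sub>M (\<Pi>\<^sub>M t\<in>T. borel)"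
    by (intro measurable_restrict measurable_coordinate index_set_diff assms)
  then show ?thesis by (simp add: path_space_def backshift_def[abs_def])
qed

lemma measurable_normalize_path:
  assumes "k \<in> borel_measurable (path_space T)"
  shows "(\<lambda>f. normalize_path T \<alpha> (k f) f) \<in> path_space T \<rightarrow>\<^sub>M path_space T"
proof -
  have [measurable]: "k \<in> borel_measurable (path_space T)" by fact
  have "(\<lambda>f. \<lambda>t\<in>T. inverse (enn2real (k f) powr (1 / \<alpha>)) *\<^sub>R f t) \<in> path_space T \<rightarrow>\<^sub>M (\<Pi>\<^sub>M t\<in>T. borel)"
  proof (rule measurable_restrict)
    fix t assume "t \<in> T"
    note [measurable] = measurable_coordinate[OF this]
    show "(\<lambda>f. inverse (enn2real (k f) powr (1 / \<alpha>)) *\<^sub>R f t) \<in> borel_measurable (path_space T)"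
      by measurable
  qed
  then show ?thesis by (simp add: path_space_def normalize_path_def[abs_def] scale_path_def)
qed

lemma epow_mult:
  assumes "0 < c"
  shows "epow (ennreal c * x) \<xi> = ennreal (c powr \<xi>) * epow x \<xi>"
proof (cases "\<xi> = 0 \<or> x = 0 \<or> x = \<infinity>")
  case True
  with assms show ?thesis
    by (auto simp: epow_def ennreal_mult_eq_top_iff ennreal_mult_top)
next
  case False
  then obtain r where "x = ennreal r" "0 < r"
    by (cases x) (auto simp: less_le)
  have "epow (ennreal c * x) \<xi> = epow (ennreal (c * r)) \<xi>"
    using \<open>x = ennreal r\<close> \<open>0 < r\<close> assms by (simp add: ennreal_mult)
  also have "\<dots> = ennreal ((c * r) powr \<xi>)"
    using \<open>0 < r\<close> assms False by (simp add: epow_def)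
  also have "\<dots> = ennreal (c powr \<xi>) * ennreal (r powr \<xi>)"
    using \<open>0 < r\<close> assms by (simp add: powr_mult ennreal_mult)
  also have "ennreal (r powr \<xi>) = epow x \<xi>"
    using \<open>x = ennreal r\<close> \<open>0 < r\<close> False by (simp add: epow_def)
  finally show ?thesis .
qed

lemma measurable_epow:
  assumes "X \<in> borel_measurable K"
  shows "(\<lambda>x. epow (X x) \<xi>) \<in> borel_measurable K"
proof -
  have [measurable]: "X \<in> borel_measurable K" by fact
  show ?thesis
    unfolding epow_def by (cases "\<xi> = 0"; cases "0 < \<xi>") simp_all
qed

locale homogeneous_functional =
  fixes T :: "(real ^ 'l) set" and \<alpha> :: real
    and \<kappa> :: "('l, 'd::finite) path \<Rightarrow> ennreal"
  assumes index_set: "index_set T" and alpha_pos: "0 < \<alpha>"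
    and hom_kappa: "(\<lambda>f. enn2ereal (\<kappa> f)) \<in> hom_maps T \<alpha>"
begin

abbreviation "at_shift h f \<equiv> \<kappa> (backshift T h f)"

lemma measurable_kappa: "\<kappa> \<in> borel_measurable (path_space T)"
proof -
  have "(\<lambda>f. e2ennreal (enn2ereal (\<kappa> f))) \<in> borel_measurable (path_space T)"
    using hom_kappa by (intro measurable_compose[OF _ measurable_e2ennreal]) (simp add: hom_maps_def meas_maps_def)
  then show ?thesis by simp
qed

lemma measurable_at_shift: "h \<in> T \<Longrightarrow> at_shift h \<in> borel_measurable (path_space T)"
  by (rule measurable_compose[OF measurable_backshift measurable_kappa]) (rule index_set)

lemma at_shift_scale_path:
  assumes "h \<in> T" "0 < c"
  shows "at_shift h (scale_path T c f) = ennreal (c powr \<alpha>) * at_shift h f"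
proof -
  have "enn2ereal (\<kappa> (scale_path T c (backshift T h f))) =
      ereal (c powr \<alpha>) * enn2ereal (\<kappa> (backshift T h f))"
    using hom_kappa assms(2) backshift_in_space[of T h f]
    by (auto simp: hom_maps_def homogeneous_def)
  also have "\<dots> = enn2ereal (ennreal (c powr \<alpha>) * at_shift h f)"
    by (simp add: times_ennreal.rep_eq)
  finally show ?thesis
    using index_set assms(1) by (simp add: backshift_scale_path enn2ereal_inject)
qed

lemma inverse_powr_alpha:
  assumes "0 < k" "k < \<infinity>"
  shows "0 < inverse (enn2real k powr (1 / \<alpha>))"
    and "ennreal (inverse (enn2real k powr (1 / \<alpha>)) powr \<alpha>) * k = 1"
proof -
  obtain r where k: "k = ennreal r" "0 < r"
    using assms by (cases k) (auto simp: less_le)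
  then show "0 < inverse (enn2real k powr (1 / \<alpha>))" by simp
  have "inverse (r powr (1 / \<alpha>)) powr \<alpha> = inverse r"
    using k(2) alpha_pos by (simp add: inverse_powr powr_powr)
  with k show "ennreal (inverse (enn2real k powr (1 / \<alpha>)) powr \<alpha>) * k = 1"
    by (simp add: ennreal_mult[symmetric])
qed


section \<open>Admissible fields\<close>

lemma admissibleD:
  assumes "admissible T \<kappa> M V"
  shows "prob_space M" "complete_measure M" "V \<in> M \<rightarrow>\<^sub>M path_space T"
    "stoch_continuous T M (\<lambda>t \<omega>. at_shift (- t) (V \<omega>))"
    "(\<lambda>(t, \<omega>). at_shift t (V \<omega>)) \<in> borel_measurable (restrict_space borel T \<Otimes>\<^sub>M M)"
  using assms by (auto simp: admissible_def random_fields_def)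

text \<open>By separability every value \<open>\<kappa> (B\<^sup>t V)\<close> is a limit of values at rational points, and these
  points stay in a box. The supremum over the rational points of a box is integrable, hence almost
  surely finite, so one null set serves all \<open>t\<close> at once. The value \<open>\<infinity>\<close> has to be excluded because
  normalising by it replaces the path by the zero path, which forgets the path.\<close>

lemma admissible_AE_finite:
  assumes adm: "admissible T \<kappa> M V"
  shows "AE \<omega> in M. \<forall>t\<in>T. at_shift t (V \<omega>) < \<infinity>"
proof -
  let ?R = "\<lambda>m. {t \<in> rational_points T. \<forall>i. \<bar>t $ i\<bar> \<le> real (Suc m)}"
  have T_rat: "t \<in> T" if "t \<in> rational_points T" for t
    using that by (simp add: rational_points_def)
  have "AE \<omega> in M. (SUP t\<in>?R m. at_shift (- t) (V \<omega>)) \<noteq> \<infinity>" for m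
  proof (rule nn_integral_PInf_AE)
    show "(\<lambda>\<omega>. SUP t\<in>?R m. at_shift (- t) (V \<omega>)) \<in> borel_measurable M"
    proof (rule borel_measurable_SUP)
      show "countable (?R m)"
        by (rule countable_subset[OF _ countable_rational_points[of T]]) auto
      show "(\<lambda>\<omega>. at_shift (- t) (V \<omega>)) \<in> borel_measurable M" if "t \<in> ?R m" for t
        using that by (intro measurable_compose[OF admissibleD(3)[OF adm] measurable_at_shift]
            index_set_uminus index_set T_rat) auto
    qed
    have "real (Suc m) > 0" by simp
    with adm have "(\<integral>\<^sup>+\<omega>. (SUP t\<in>?R m. at_shift (- t) (V \<omega>)) \<partial>M) < \<infinity>"
      unfolding admissible_def by blast
    then show "(\<integral>\<^sup>+\<omega>. (SUP t\<in>?R m. at_shift (- t) (V \<omega>)) \<partial>M) \<noteq> \<infinity>" by simp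
  qed
  then have "AE \<omega> in M. \<forall>m. (SUP t\<in>?R m. at_shift (- t) (V \<omega>)) \<noteq> \<infinity>"
    by (simp add: AE_all_countable)
  moreover have "separable_field T (rational_points T) M (\<lambda>t \<omega>. at_shift t (V \<omega>))"
    using adm by (simp add: admissible_def random_fields_def)
  then have "AE \<omega> in M. \<forall>t\<in>T. \<exists>s :: nat \<Rightarrow> real ^ 'l. (\<forall>n. s n \<in> rational_points T) \<and> s \<longlonglongrightarrow> t \<and>
      (\<lambda>n. at_shift (s n) (V \<omega>)) \<longlonglongrightarrow> at_shift t (V \<omega>)"
    by (simp add: separable_field_def)
  ultimately show ?thesis
  proof eventually_elim
    fix \<omega>
    assume fin: "\<forall>m. (SUP t\<in>?R m. at_shift (- t) (V \<omega>)) \<noteq> \<infinity>"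
      and sep: "\<forall>t\<in>T. \<exists>s :: nat \<Rightarrow> real ^ 'l. (\<forall>n. s n \<in> rational_points T) \<and> s \<longlonglongrightarrow> t \<and>
      (\<lambda>n. at_shift (s n) (V \<omega>)) \<longlonglongrightarrow> at_shift t (V \<omega>)"
    show "\<forall>t\<in>T. at_shift t (V \<omega>) < \<infinity>"
    proof
      fix t assume "t \<in> T"
      with sep obtain s :: "nat \<Rightarrow> real ^ 'l" where s: "\<And>n. s n \<in> rational_points T" "s \<longlonglongrightarrow> t"
        "(\<lambda>n. at_shift (s n) (V \<omega>)) \<longlonglongrightarrow> at_shift t (V \<omega>)" by blast
      have "bounded (range s)"
        by (rule convergent_imp_bounded) (rule s(2))
      then obtain b where b: "\<And>n. norm (s n) \<le> b"
        by (auto simp: bounded_iff)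
      \<comment> \<open>The box has half-width \<open>Suc m\<close> because half-widths must be positive.\<close>
      obtain m :: nat where m: "b \<le> real m" using real_arch_simple by blast
      have "- s n \<in> ?R m" for n
      proof -
        have "\<bar>(- s n) $ i\<bar> \<le> real (Suc m)" for i
          using component_le_norm_cart[of "s n" i] b[of n] m by simp
        moreover have "- s n \<in> rational_points T"
          using s(1)[of n] index_set_uminus[OF index_set] by (simp add: rational_points_def)
        ultimately show ?thesis by simp
      qed
      then have "at_shift (- (- s n)) (V \<omega>) \<le> (SUP t\<in>?R m. at_shift (- t) (V \<omega>))" for n
        by (rule SUP_upper)
      then have "at_shift t (V \<omega>) \<le> (SUP t\<in>?R m. at_shift (- t) (V \<omega>))"
        by (intro LIMSEQ_le_const2[OF s(3)]) simp
      also have "\<dots> < \<infinity>" using fin[rule_format, of m] less_top[of "SUP t\<in>?R m. at_shift (- t) (V \<omega>)"]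
        unfolding infinity_ennreal_def by (rule iffD1[rotated])
      finally show "at_shift t (V \<omega>) < \<infinity>" .
    qed
  qed
qed

lemma admissible_AE_nontrivial:
  assumes adm: "admissible T \<kappa> M V"
  shows "AE \<omega> in M. \<exists>t\<in>rational_points T. 0 < at_shift (- t) (V \<omega>)"
proof -
  interpret prob_space M by (rule admissibleD(1)) fact
  have "AE \<omega> in M. \<omega> \<in> {\<omega> \<in> space M. (SUP t\<in>rational_points T. at_shift (- t) (V \<omega>)) > 0}"
    using adm by (intro AE_prob_1) (simp add: admissible_def)
  then show ?thesis
    by eventually_elim (simp add: less_SUP_iff)
qed

section \<open>Normalised paths determine homogeneous expectations\<close>

lemma class_identity_nn_integral:
  assumes V: "V \<in> M \<rightarrow>\<^sub>M path_space T" and W: "W \<in> N \<rightarrow>\<^sub>M path_space T"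
    and cls: "class_identity T \<alpha> \<kappa> M V N W"
    and p: "p \<in> borel_measurable (path_space T)" and h: "h \<in> T"
  shows "(\<integral>\<^sup>+\<omega>. at_shift (- h) (V \<omega>) * p (normalize_path T \<alpha> (at_shift (- h) (V \<omega>)) (V \<omega>)) \<partial>M) =
         (\<integral>\<^sup>+\<omega>. at_shift (- h) (W \<omega>) * p (normalize_path T \<alpha> (at_shift (- h) (W \<omega>)) (W \<omega>)) \<partial>N)"
proof -
  note k = measurable_at_shift[OF index_set_uminus[OF index_set h]]
  have q: "(\<lambda>f. at_shift (- h) f * p (normalize_path T \<alpha> (at_shift (- h) f) f))
      \<in> borel_measurable (path_space T)"
    by (intro borel_measurable_times_ennreal k measurable_compose[OF measurable_normalize_path[OF k] p])
  have "(\<lambda>f. enn2ereal (p f)) \<in> meas_maps T"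
    using p by (simp add: meas_maps_def)
  with cls h have "same_expectation
       N (\<lambda>\<omega>. enn2ereal (at_shift (- h) (W \<omega>) * p (normalize_path T \<alpha> (at_shift (- h) (W \<omega>)) (W \<omega>))))
       M (\<lambda>\<omega>. enn2ereal (at_shift (- h) (V \<omega>) * p (normalize_path T \<alpha> (at_shift (- h) (V \<omega>)) (V \<omega>))))"
    unfolding class_identity_def by (fastforce simp: Let_def times_ennreal.rep_eq)
  from same_expectation_nonneg[OF measurable_compose[OF W q] measurable_compose[OF V q] this]
  show ?thesis by simp
qed

text \<open>The index of the first point of a countable set at which \<open>\<kappa>\<close> is positive cuts the path space
  into scale-invariant pieces; on the piece number \<open>j\<close> one may normalise by the value at \<open>q j\<close>.\<close>

definition first_positive :: "(nat \<Rightarrow> real ^ 'l) \<Rightarrow> nat \<Rightarrow> ('l, 'd) path set" where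
  "first_positive q j = {f \<in> space (path_space T).
     0 < at_shift (- q j) f \<and> (\<forall>i<j. at_shift (- q i) f = 0)}"

lemma sets_first_positive:
  assumes "\<And>n. q n \<in> T"
  shows "first_positive q j \<in> sets (path_space T)"
proof -
  note [measurable] = measurable_at_shift[OF index_set_uminus[OF index_set assms]]
  show ?thesis unfolding first_positive_def by measurable
qed

lemma scale_path_first_positive_iff:
  assumes "\<And>n. q n \<in> T" "0 < c" "f \<in> space (path_space T)"
  shows "scale_path T c f \<in> first_positive q j \<longleftrightarrow> f \<in> first_positive q j"
  using assms(2,3)
  by (simp add: first_positive_def scale_path_in_space index_set_uminus[OF index_set] assms(1)
      at_shift_scale_path ennreal_zero_less_mult_iff)

lemma disjoint_first_positive: "disjoint_family (first_positive q)"
proof -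
  have "i = j" if "f \<in> first_positive q i" "f \<in> first_positive q j" for f i j
    using that by (cases i j rule: linorder_cases) (auto simp: first_positive_def)
  then show ?thesis unfolding disjoint_family_on_def by blast
qed

text \<open>On the piece number \<open>j\<close> homogeneity gives \<open>G f = k * G (f / k powr (1/\<alpha>))\<close> for the value \<open>k\<close> of
  \<open>\<kappa>\<close> at \<open>q j\<close>, and almost every path lies in some piece. The integral of \<open>G\<close> thus becomes a
  series of expectations of the form that occurs in the class identity. The map \<open>G\<close> only has to agree with a
  measurable map on a scale-invariant set \<open>S\<close> carrying the field: normalised paths remain in \<open>S\<close>.\<close>

lemma homogeneous_nn_integral_decomposition:
  assumes adm: "admissible T \<kappa> M V"
    and q: "range q = rational_points T"
    and S: "AE \<omega> in M. V \<omega> \<in> S" "S \<subseteq> space (path_space T)"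
      "\<And>c f. 0 < c \<Longrightarrow> f \<in> S \<Longrightarrow> scale_path T c f \<in> S"
    and G: "\<And>c f. 0 < c \<Longrightarrow> f \<in> S \<Longrightarrow> G (scale_path T c f) = ennreal (c powr \<alpha>) * G f"
    and G': "G' \<in> borel_measurable (path_space T)" "\<And>f. f \<in> S \<Longrightarrow> G f = G' f"
  shows "(\<integral>\<^sup>+\<omega>. G (V \<omega>) \<partial>M) = (\<Sum>j. \<integral>\<^sup>+\<omega>. at_shift (- q j) (V \<omega>) *
           (G' (normalize_path T \<alpha> (at_shift (- q j) (V \<omega>)) (V \<omega>)) *
            indicator (first_positive q j) (normalize_path T \<alpha> (at_shift (- q j) (V \<omega>)) (V \<omega>))) \<partial>M)"
proof -
  note V = admissibleD(3)[OF adm]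
  have qT: "q n \<in> T" for n
    using q by (auto simp: rational_points_def)
  note sets_D = sets_first_positive[OF qT]
  have "(\<integral>\<^sup>+\<omega>. G (V \<omega>) \<partial>M) = (\<integral>\<^sup>+\<omega>. (\<Sum>j. G' (V \<omega>) * indicator (first_positive q j) (V \<omega>)) \<partial>M)"
  proof (rule nn_integral_cong_AE)
    show "AE \<omega> in M. G (V \<omega>) = (\<Sum>j. G' (V \<omega>) * indicator (first_positive q j) (V \<omega>))"
      using admissible_AE_nontrivial[OF adm] S(1)
    proof eventually_elim
      fix \<omega> assume "\<exists>t\<in>rational_points T. 0 < at_shift (- t) (V \<omega>)" and VS: "V \<omega> \<in> S"
      then have ex: "\<exists>j. 0 < at_shift (- q j) (V \<omega>)"
        unfolding q[symmetric] by blast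
      define j where "j = (LEAST j. 0 < at_shift (- q j) (V \<omega>))"
      have "V \<omega> \<in> first_positive q j"
      proof -
        have "0 < at_shift (- q j) (V \<omega>)"
          unfolding j_def by (rule LeastI_ex) (rule ex)
        moreover have "at_shift (- q i) (V \<omega>) = 0" if "i < j" for i
          using not_less_Least[OF that[unfolded j_def]] by (simp add: not_less)
        ultimately show ?thesis
          using VS S(2) by (auto simp: first_positive_def)
      qed
      then have "(\<Sum>j. indicator (first_positive q j) (V \<omega>) :: ennreal) = 1"
        unfolding suminf_indicator[OF disjoint_first_positive] by (intro indicator_simps(1)) blast
      then show "G (V \<omega>) = (\<Sum>j. G' (V \<omega>) * indicator (first_positive q j) (V \<omega>))"
        using G'(2)[OF VS] by (simp only: ennreal_suminf_cmult mult_1_right)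
    qed
  qed
  also have "\<dots> = (\<Sum>j. \<integral>\<^sup>+\<omega>. G' (V \<omega>) * indicator (first_positive q j) (V \<omega>) \<partial>M)"
    by (intro nn_integral_suminf borel_measurable_times_ennreal measurable_compose[OF V G'(1)]
        measurable_compose[OF V borel_measurable_indicator[OF sets_D]])
  also have "\<dots> = (\<Sum>j. \<integral>\<^sup>+\<omega>. at_shift (- q j) (V \<omega>) *
           (G' (normalize_path T \<alpha> (at_shift (- q j) (V \<omega>)) (V \<omega>)) *
            indicator (first_positive q j) (normalize_path T \<alpha> (at_shift (- q j) (V \<omega>)) (V \<omega>))) \<partial>M)"
  proof (intro suminf_cong nn_integral_cong_AE)
    fix j
    show "AE \<omega> in M. G' (V \<omega>) * indicator (first_positive q j) (V \<omega>) = at_shift (- q j) (V \<omega>) *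
           (G' (normalize_path T \<alpha> (at_shift (- q j) (V \<omega>)) (V \<omega>)) *
            indicator (first_positive q j) (normalize_path T \<alpha> (at_shift (- q j) (V \<omega>)) (V \<omega>)))"
      using admissible_AE_finite[OF adm] S(1)
    proof eventually_elim
      fix \<omega> assume fin: "\<forall>t\<in>T. at_shift t (V \<omega>) < \<infinity>" and VS: "V \<omega> \<in> S"
      define k where "k = at_shift (- q j) (V \<omega>)"
      define c where "c = inverse (enn2real k powr (1 / \<alpha>))"
      have k_fin: "k < \<infinity>"
        using fin index_set_uminus[OF index_set qT] by (simp add: k_def)
      show "G' (V \<omega>) * indicator (first_positive q j) (V \<omega>) = at_shift (- q j) (V \<omega>) *
           (G' (normalize_path T \<alpha> (at_shift (- q j) (V \<omega>)) (V \<omega>)) *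
            indicator (first_positive q j) (normalize_path T \<alpha> (at_shift (- q j) (V \<omega>)) (V \<omega>)))"
      proof (cases "k = 0")
        case True
        then have "V \<omega> \<notin> first_positive q j"
          by (simp add: first_positive_def k_def)
        with True show ?thesis by (simp add: k_def)
      next
        case False
        then have "0 < k" by (simp add: zero_less_iff_neq_zero)
        note c = inverse_powr_alpha[OF this k_fin, folded c_def]
        have "k * G' (scale_path T c (V \<omega>)) = (ennreal (c powr \<alpha>) * k) * G' (V \<omega>)"
          using G[OF c(1) VS] G'(2)[OF VS] G'(2)[OF S(3)[OF c(1) VS]] by (simp add: ac_simps)
        then have "k * G' (scale_path T c (V \<omega>)) = G' (V \<omega>)"
          by (simp add: c(2))
        moreover have "scale_path T c (V \<omega>) \<in> first_positive q j \<longleftrightarrow> V \<omega> \<in> first_positive q j"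
          using S(2) VS by (intro scale_path_first_positive_iff qT c) auto
        then have "indicator (first_positive q j) (scale_path T c (V \<omega>)) =
            (indicator (first_positive q j) (V \<omega>) :: ennreal)"
          by (simp add: indicator_def)
        ultimately show ?thesis
          by (simp add: normalize_path_def flip: k_def c_def mult.assoc)
      qed
    qed
  qed
  finally show ?thesis .
qed

lemma class_identity_homogeneous_nn_integral:
  assumes V: "admissible T \<kappa> M V" and W: "admissible T \<kappa> N W"
    and cls: "class_identity T \<alpha> \<kappa> M V N W"
    and S: "AE \<omega> in M. V \<omega> \<in> S" "AE \<omega> in N. W \<omega> \<in> S" "S \<subseteq> space (path_space T)"
      "\<And>c f. 0 < c \<Longrightarrow> f \<in> S \<Longrightarrow> scale_path T c f \<in> S"
    and G: "\<And>c f. 0 < c \<Longrightarrow> f \<in> S \<Longrightarrow> G (scale_path T c f) = ennreal (c powr \<alpha>) * G f"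
    and G': "G' \<in> borel_measurable (path_space T)" "\<And>f. f \<in> S \<Longrightarrow> G f = G' f"
  shows "(\<integral>\<^sup>+\<omega>. G (V \<omega>) \<partial>M) = (\<integral>\<^sup>+\<omega>. G (W \<omega>) \<partial>N)"
proof -
  have "0 \<in> rational_points T"
    using index_set_zero[OF index_set] by (simp add: rational_points_def)
  then obtain q :: "nat \<Rightarrow> real ^ 'l" where q: "range q = rational_points T"
    using range_from_nat_into[OF _ countable_rational_points[of T]] by blast
  then have qT: "q n \<in> T" for n
    by (auto simp: rational_points_def)
  have "(\<lambda>f. G' f * indicator (first_positive q j) f) \<in> borel_measurable (path_space T)" for j
    by (intro borel_measurable_times_ennreal G'(1) borel_measurable_indicator sets_first_positive qT)
  note eq = class_identity_nn_integral[OF admissibleD(3)[OF V] admissibleD(3)[OF W] cls this qT]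
  have "(\<integral>\<^sup>+\<omega>. G (V \<omega>) \<partial>M) = (\<Sum>j. \<integral>\<^sup>+\<omega>. at_shift (- q j) (V \<omega>) *
           (G' (normalize_path T \<alpha> (at_shift (- q j) (V \<omega>)) (V \<omega>)) *
            indicator (first_positive q j) (normalize_path T \<alpha> (at_shift (- q j) (V \<omega>)) (V \<omega>))) \<partial>M)"
    by (rule homogeneous_nn_integral_decomposition[OF V q S(1,3,4) G G'])
  also have "\<dots> = (\<Sum>j. \<integral>\<^sup>+\<omega>. at_shift (- q j) (W \<omega>) *
           (G' (normalize_path T \<alpha> (at_shift (- q j) (W \<omega>)) (W \<omega>)) *
            indicator (first_positive q j) (normalize_path T \<alpha> (at_shift (- q j) (W \<omega>)) (W \<omega>))) \<partial>N)"
    by (intro suminf_cong eq)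
  also have "\<dots> = (\<integral>\<^sup>+\<omega>. G (W \<omega>) \<partial>N)"
    by (rule homogeneous_nn_integral_decomposition[OF W q S(2,3,4) G G', symmetric])
  finally show ?thesis .
qed

text \<open>Maps built from path integrals may fail to be measurable for the product \<open>\<sigma>\<close>-field;
  completeness of the two probability spaces still turns \<open>H\<close>, composed with a field, into a random
  variable. Its positive and its negative part are homogeneous and are treated separately.\<close>

lemma class_identity_homogeneous_same_expectation:
  assumes V: "admissible T \<kappa> M V" and W: "admissible T \<kappa> N W"
    and cls: "class_identity T \<alpha> \<kappa> M V N W"
    and S: "AE \<omega> in M. V \<omega> \<in> S" "AE \<omega> in N. W \<omega> \<in> S" "S \<subseteq> space (path_space T)"
      "\<And>c f. 0 < c \<Longrightarrow> f \<in> S \<Longrightarrow> scale_path T c f \<in> S"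
    and H: "homogeneous T \<alpha> H"
    and H': "H' \<in> borel_measurable (path_space T)" "\<And>f. f \<in> S \<Longrightarrow> H f = H' f"
  shows "same_expectation M (\<lambda>\<omega>. H (V \<omega>)) N (\<lambda>\<omega>. H (W \<omega>))"
proof (rule same_expectationI)
  interpret M: complete_measure M by (rule admissibleD(2)) fact
  interpret N: complete_measure N by (rule admissibleD(2)) fact
  have hom: "H (scale_path T c f) = enn2ereal (ennreal (c powr \<alpha>)) * H f" if "0 < c" "f \<in> S" for c f
    using H that S(3) by (auto simp: homogeneous_def)
  show "(\<lambda>\<omega>. H (V \<omega>)) \<in> borel_measurable M"
  proof (rule M.measurable_AE_eq)
    show "(\<lambda>\<omega>. H' (V \<omega>)) \<in> borel_measurable M"
      by (rule measurable_compose[OF admissibleD(3)[OF V] H'(1)])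
    show "AE \<omega> in M. H' (V \<omega>) = H (V \<omega>)"
      using S(1) by eventually_elim (simp add: H'(2))
  qed
  show "(\<lambda>\<omega>. H (W \<omega>)) \<in> borel_measurable N"
  proof (rule N.measurable_AE_eq)
    show "(\<lambda>\<omega>. H' (W \<omega>)) \<in> borel_measurable N"
      by (rule measurable_compose[OF admissibleD(3)[OF W] H'(1)])
    show "AE \<omega> in N. H' (W \<omega>) = H (W \<omega>)"
      using S(2) by eventually_elim (simp add: H'(2))
  qed
  show "(\<integral>\<^sup>+\<omega>. e2ennreal (H (V \<omega>)) \<partial>M) = (\<integral>\<^sup>+\<omega>. e2ennreal (H (W \<omega>)) \<partial>N)"
  proof (rule class_identity_homogeneous_nn_integral[OF V W cls S])
    show "(\<lambda>f. e2ennreal (H' f)) \<in> borel_measurable (path_space T)"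
      by (rule measurable_compose[OF H'(1) measurable_e2ennreal])
    show "e2ennreal (H (scale_path T c f)) = ennreal (c powr \<alpha>) * e2ennreal (H f)"
      if "0 < c" "f \<in> S" for c f
      unfolding hom[OF that] e2ennreal_mult_left ..
  qed (simp_all add: H'(2))
  show "(\<integral>\<^sup>+\<omega>. e2ennreal (- H (V \<omega>)) \<partial>M) = (\<integral>\<^sup>+\<omega>. e2ennreal (- H (W \<omega>)) \<partial>N)"
  proof (rule class_identity_homogeneous_nn_integral[OF V W cls S])
    show "(\<lambda>f. e2ennreal (- H' f)) \<in> borel_measurable (path_space T)"
      by (intro measurable_compose[OF _ measurable_e2ennreal] borel_measurable_uminus_ereal H'(1))
    show "e2ennreal (- H (scale_path T c f)) = ennreal (c powr \<alpha>) * e2ennreal (- H f)"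
      if "0 < c" "f \<in> S" for c f
      unfolding hom[OF that] e2ennreal_mult_left[symmetric] by simp
  qed (simp_all add: H'(2))
qed

end

section \<open>Sampling the trace of a path\<close>

text \<open>Closeness is expressed without subtraction, as in the definition of stochastic continuity, so
  that the value \<open>\<infinity>\<close> needs no separate treatment.\<close>

lemma ennreal_tendsto_if_close:
  fixes X :: "nat \<Rightarrow> ennreal"
  assumes "\<forall>\<^sub>F n in sequentially. X n \<le> x + ennreal (e n) \<and> x \<le> X n + ennreal (e n)"
    and e: "e \<longlonglongrightarrow> 0"
  shows "X \<longlonglongrightarrow> x"
proof (rule tendsto_sandwich)
  have e': "(\<lambda>n. ennreal (e n)) \<longlonglongrightarrow> 0"
    using tendsto_ennrealI[OF e] by simp
  show "\<forall>\<^sub>F n in sequentially. x - ennreal (e n) \<le> X n"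
    using assms(1) by eventually_elim (simp add: ennreal_minus_le_iff add.commute)
  show "\<forall>\<^sub>F n in sequentially. X n \<le> x + ennreal (e n)"
    using assms(1) by eventually_elim simp
  have "(\<lambda>n. x - ennreal (e n)) \<longlonglongrightarrow> x - 0"
    by (rule tendsto_diff_ennreal_general[OF tendsto_const e']) simp
  then show "(\<lambda>n. x - ennreal (e n)) \<longlonglongrightarrow> x" by simp
  have "(\<lambda>n. x + ennreal (e n)) \<longlonglongrightarrow> x + 0"
    by (rule tendsto_add[OF tendsto_const e'])
  then show "(\<lambda>n. x + ennreal (e n)) \<longlonglongrightarrow> x" by simp
qed

context homogeneous_functional
begin

text \<open>Evaluation points \<open>r n t\<close> at which \<open>\<kappa>\<close> depends measurably on \<open>t\<close> and the path jointly. With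
  \<open>t\<close> in place of \<open>r n t\<close> this fails in general if \<open>T\<close> is uncountable.\<close>

definition sampling :: "(nat \<Rightarrow> real ^ 'l \<Rightarrow> real ^ 'l) \<Rightarrow> bool" where
  "sampling r \<longleftrightarrow> (\<forall>n. (\<forall>t\<in>T. r n t \<in> T) \<and>
     (\<lambda>(t, f). at_shift (- r n t) f) \<in> borel_measurable (base_measure T \<Otimes>\<^sub>M path_space T))"

text \<open>The paths whose trace \<open>t \<mapsto> \<kappa> (B\<^sup>-\<^sup>t f)\<close> is recovered almost everywhere from its samples. On them path integrals
  are limits of product measurable quantities, and scaling does not lead out of them.\<close>

definition sampled_paths :: "(nat \<Rightarrow> real ^ 'l \<Rightarrow> real ^ 'l) \<Rightarrow> ('l, 'd) path set" where
  "sampled_paths r = {f \<in> space (path_space T).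
     (\<lambda>t. at_shift (- t) f) \<in> borel_measurable (base_measure T) \<and>
     (AE t in base_measure T. (\<lambda>n. at_shift (- r n t) f) \<longlonglongrightarrow> at_shift (- t) f)}"

lemma measurable_trace:
  assumes adm: "admissible T \<kappa> M V" and "\<omega> \<in> space M"
  shows "(\<lambda>t. at_shift (- t) (V \<omega>)) \<in> borel_measurable (base_measure T)"
proof (cases "T = UNIV")
  case True
  have "(\<lambda>(t, \<omega>). at_shift t (V \<omega>)) \<in> borel_measurable (borel \<Otimes>\<^sub>M M)"
    using admissibleD(5)[OF adm] by (simp add: True restrict_UNIV)
  moreover have "(\<lambda>t. (- t, \<omega>)) \<in> base_measure T \<rightarrow>\<^sub>M borel \<Otimes>\<^sub>M M"
    using assms(2) by (intro measurable_Pair) (simp_all add: base_measure_def True)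
  ultimately show ?thesis
    using measurable_compose by fastforce
qed (simp add: base_measure_def)

lemma scale_path_sampled_paths:
  assumes r: "sampling r" and "0 < c" "f \<in> sampled_paths r"
  shows "scale_path T c f \<in> sampled_paths r"
proof -
  have shift: "at_shift (- t) (scale_path T c f) = ennreal (c powr \<alpha>) * at_shift (- t) f" if "t \<in> T" for t
    using that assms(2) index_set_uminus[OF index_set] by (simp add: at_shift_scale_path)
  have trace: "(\<lambda>t. at_shift (- t) f) \<in> borel_measurable (base_measure T)"
    "AE t in base_measure T. (\<lambda>n. at_shift (- r n t) f) \<longlonglongrightarrow> at_shift (- t) f"
    using assms(3) by (simp_all add: sampled_paths_def)
  have "(\<lambda>t. ennreal (c powr \<alpha>) * at_shift (- t) f) \<in> borel_measurable (base_measure T)"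
    using trace(1) by (intro borel_measurable_times_ennreal) simp_all
  also have "(\<lambda>t. ennreal (c powr \<alpha>) * at_shift (- t) f) \<in> borel_measurable (base_measure T) \<longleftrightarrow>
      (\<lambda>t. at_shift (- t) (scale_path T c f)) \<in> borel_measurable (base_measure T)"
    by (rule measurable_cong) (rule shift[symmetric], simp only: space_base_measure)
  finally have "(\<lambda>t. at_shift (- t) (scale_path T c f)) \<in> borel_measurable (base_measure T)" .
  moreover have "AE t in base_measure T.
      (\<lambda>n. at_shift (- r n t) (scale_path T c f)) \<longlonglongrightarrow> at_shift (- t) (scale_path T c f)"
    using trace(2) AE_space[of "base_measure T"]
  proof eventually_elim
    case (elim t)
    then have "t \<in> T" by (simp add: space_base_measure)
    with elim(1) show ?case
      using r by (simp add: shift sampling_def ennreal_tendsto_cmult)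
  qed
  ultimately show ?thesis
    unfolding sampled_paths_def using scale_path_in_space by blast
qed

text \<open>The event whose probability tends to \<open>0\<close> in the definition of stochastic continuity.\<close>

abbreviation far :: "real \<Rightarrow> ennreal \<Rightarrow> ennreal \<Rightarrow> bool" where
  "far \<epsilon> x y \<equiv> \<not> (x \<le> y + ennreal \<epsilon> \<and> y \<le> x + ennreal \<epsilon>)"

text \<open>A simple function has finitely many values, so the field is only evaluated at finitely many
  points, where measurability in \<open>f\<close> alone suffices.\<close>

lemma measurable_sampled_shift:
  assumes T: "T = UNIV" and r: "simple_function borel r"
  shows "(\<lambda>(t, f). at_shift (- r t) f) \<in> borel_measurable (lborel \<Otimes>\<^sub>M path_space T)"
proof -
  have "(\<lambda>x. at_shift (- (r (fst x))) (snd x)) \<in> borel_measurable (lborel \<Otimes>\<^sub>M path_space T)"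
  proof (rule measurable_compose_countable'[where I = "range r" and g = "\<lambda>x. r (fst x)"
        and f = "\<lambda>s x. at_shift (- s) (snd x)"])
    show "(\<lambda>x. at_shift (- s) (snd x)) \<in> borel_measurable (lborel \<Otimes>\<^sub>M path_space T)" for s
      by (rule measurable_compose[OF measurable_snd measurable_at_shift]) (simp add: T)
    have "r \<in> borel \<rightarrow>\<^sub>M count_space (range r)"
      using r by (simp add: simple_function_def measurable_count_space_eq2)
    then have "r \<in> lborel \<rightarrow>\<^sub>M count_space (range r)" by simp
    then show "(\<lambda>x. r (fst x)) \<in> lborel \<Otimes>\<^sub>M path_space T \<rightarrow>\<^sub>M count_space (range r)"
      by (rule measurable_compose[OF measurable_fst])
    show "countable (range r)"
      using r by (simp add: simple_function_def countable_finite)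
  qed
  then show ?thesis by (simp add: case_prod_beta')
qed

lemma measurable_deviation:
  assumes T: "T = UNIV" and adm: "admissible T \<kappa> M V" and r: "simple_function borel r"
    and \<mu>: "sets \<mu> = sets borel"
  shows "{x \<in> space (M \<Otimes>\<^sub>M \<mu>). far \<epsilon> (at_shift (- r (snd x)) (V (fst x))) (at_shift (- snd x) (V (fst x)))}
    \<in> sets (M \<Otimes>\<^sub>M \<mu>)"
proof -
  note V = admissibleD(3)[OF adm]
  have snd: "snd \<in> M \<Otimes>\<^sub>M \<mu> \<rightarrow>\<^sub>M borel"
    using measurable_snd[of M \<mu>] measurable_cong_sets[OF refl \<mu>] by blast
  have joint: "(\<lambda>(t, \<omega>). at_shift t (V \<omega>)) \<in> borel_measurable (borel \<Otimes>\<^sub>M M)"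
    using admissibleD(5)[OF adm] by (simp add: T restrict_UNIV)
  have "(\<lambda>x. (- snd x, fst x)) \<in> M \<Otimes>\<^sub>M \<mu> \<rightarrow>\<^sub>M borel \<Otimes>\<^sub>M M"
    using snd by (intro measurable_Pair) auto
  from measurable_compose[OF this joint]
  have [measurable]: "(\<lambda>x. at_shift (- snd x) (V (fst x))) \<in> borel_measurable (M \<Otimes>\<^sub>M \<mu>)"
    by simp
  have "(\<lambda>x. (snd x, V (fst x))) \<in> M \<Otimes>\<^sub>M \<mu> \<rightarrow>\<^sub>M lborel \<Otimes>\<^sub>M path_space T"
    using snd V by (intro measurable_Pair) (auto intro: measurable_compose[OF measurable_fst])
  from measurable_compose[OF this measurable_sampled_shift[OF T r]]
  have [measurable]: "(\<lambda>x. at_shift (- r (snd x)) (V (fst x))) \<in> borel_measurable (M \<Otimes>\<^sub>M \<mu>)"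
    by simp
  show ?thesis by measurable
qed

text \<open>Stochastic continuity makes the probability of a deviation tend to \<open>0\<close> for each fixed \<open>t\<close>.
  Tonelli's theorem and dominated convergence, with the constant \<open>1\<close> as bound on the finite measure
  \<open>\<mu>\<close>, carry this over to the product measure.\<close>

lemma deviation_tendsto_0:
  assumes T: "T = UNIV" and adm: "admissible T \<kappa> M V"
    and r: "\<And>n. simple_function borel (r n)" "\<And>t. (\<lambda>n. r n t) \<longlonglongrightarrow> t"
    and \<mu>: "sets \<mu> = sets borel" "finite_measure \<mu>" and \<epsilon>: "0 < \<epsilon>"
  shows "(\<lambda>n. emeasure (M \<Otimes>\<^sub>M \<mu>) {x \<in> space (M \<Otimes>\<^sub>M \<mu>).
     far \<epsilon> (at_shift (- r n (snd x)) (V (fst x))) (at_shift (- snd x) (V (fst x)))}) \<longlonglongrightarrow> 0"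
proof -
  interpret M: prob_space M by (rule admissibleD(1)) fact
  interpret \<mu>: finite_measure \<mu> by fact
  interpret pair_sigma_finite M \<mu> ..
  let ?A = "\<lambda>n. {x \<in> space (M \<Otimes>\<^sub>M \<mu>).
     far \<epsilon> (at_shift (- r n (snd x)) (V (fst x))) (at_shift (- snd x) (V (fst x)))}"
  let ?p = "\<lambda>n t. emeasure M ((\<lambda>\<omega>. (\<omega>, t)) -` ?A n)"
  have A: "?A n \<in> sets (M \<Otimes>\<^sub>M \<mu>)" for n
    by (rule measurable_deviation[OF T adm r(1) \<mu>(1)])
  have space_\<mu>: "space \<mu> = UNIV"
    using sets_eq_imp_space_eq[OF \<mu>(1)] by simp
  have lim: "(\<lambda>n. ?p n t) \<longlonglongrightarrow> 0" for t
  proof -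
    let ?f = "\<lambda>s. measure M {\<omega> \<in> space M. far \<epsilon> (at_shift (- s) (V \<omega>)) (at_shift (- t) (V \<omega>))}"
    have "(?f \<longlongrightarrow> 0) (at t)"
      using admissibleD(4)[OF adm] \<epsilon> by (simp add: stoch_continuous_def T)
    \<comment> \<open>The limit in stochastic continuity omits the point \<open>t\<close>, which \<open>r n t\<close> may hit; but there
      the two values coincide.\<close>
    moreover have "?f t = 0" by simp
    ultimately have "isCont ?f t" by (simp add: isCont_def)
    from isCont_tendsto_compose[OF this r(2)]
    have "(\<lambda>n. ?f (r n t)) \<longlonglongrightarrow> 0" by simp
    then have "(\<lambda>n. ennreal (?f (r n t))) \<longlonglongrightarrow> ennreal 0" by (rule tendsto_ennrealI)
    moreover have "?p n t = ennreal (?f (r n t))" for n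
      unfolding M.emeasure_eq_measure[symmetric]
      by (rule arg_cong[where f = "emeasure M"]) (auto simp: space_pair_measure space_\<mu>)
    ultimately show ?thesis by simp
  qed
  have "(\<lambda>n. \<integral>\<^sup>+t. ?p n t \<partial>\<mu>) \<longlonglongrightarrow> (\<integral>\<^sup>+t. 0 \<partial>\<mu>)"
  proof (rule nn_integral_dominated_convergence[where w = "\<lambda>_. 1"])
    show "(\<lambda>t. ?p n t) \<in> borel_measurable \<mu>" for n
      by (rule measurable_emeasure_Pair2) (rule A)
    show "AE t in \<mu>. ?p n t \<le> 1" for n
      by (simp add: M.emeasure_eq_measure)
    show "(\<integral>\<^sup>+t. 1 \<partial>\<mu>) < \<infinity>"
      by (simp add: less_top[symmetric])
    show "AE t in \<mu>. (\<lambda>n. ?p n t) \<longlonglongrightarrow> 0"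
      by (rule AE_I2) (rule lim)
  qed simp_all
  then show ?thesis
    unfolding emeasure_pair_measure_alt2[OF A] by (simp only: nn_integral_const mult_zero_left)
qed

text \<open>Deviations of size \<open>2\<^sup>-\<^sup>n\<close> have summable measures, so by the Borel-Cantelli lemma almost every
  pair \<open>(\<omega>, t)\<close> eventually has none.\<close>

lemma sampling_converges_AE:
  assumes T: "T = UNIV" and adm: "admissible T \<kappa> M V"
    and r: "\<And>n. simple_function borel (r n)"
    and \<mu>: "sets \<mu> = sets borel" "finite_measure \<mu>"
    and small: "\<And>n. emeasure (M \<Otimes>\<^sub>M \<mu>) {x \<in> space (M \<Otimes>\<^sub>M \<mu>).
     far ((1/2) ^ n) (at_shift (- r n (snd x)) (V (fst x))) (at_shift (- snd x) (V (fst x)))} \<le> ennreal ((1/2) ^ n)"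
  shows "AE \<omega> in M. AE t in \<mu>. (\<lambda>n. at_shift (- r n t) (V \<omega>)) \<longlonglongrightarrow> at_shift (- t) (V \<omega>)"
proof -
  interpret M: prob_space M by (rule admissibleD(1)) fact
  interpret \<mu>: finite_measure \<mu> by fact
  interpret pair_sigma_finite M \<mu> ..
  let ?A = "\<lambda>n. {x \<in> space (M \<Otimes>\<^sub>M \<mu>).
     far ((1/2) ^ n) (at_shift (- r n (snd x)) (V (fst x))) (at_shift (- snd x) (V (fst x)))}"
  have A: "?A n \<in> sets (M \<Otimes>\<^sub>M \<mu>)" for n
    by (rule measurable_deviation[OF T adm r \<mu>(1)])
  have "AE x in M \<Otimes>\<^sub>M \<mu>. \<forall>\<^sub>F n in sequentially. x \<in> space (M \<Otimes>\<^sub>M \<mu>) - ?A n"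
  proof (rule borel_cantelli_AE1[OF A])
    show "emeasure (M \<Otimes>\<^sub>M \<mu>) (?A n) < \<infinity>" for n
      by (rule le_less_trans[OF small]) simp
    show "summable (\<lambda>n. measure (M \<Otimes>\<^sub>M \<mu>) (?A n))"
    proof (rule summable_comparison_test')
      show "summable (\<lambda>n. (1/2 :: real) ^ n)" by simp
      show "norm (measure (M \<Otimes>\<^sub>M \<mu>) (?A n)) \<le> (1/2) ^ n" if "0 \<le> n" for n
        using small[of n] unfolding measure_def
        by (simp add: enn2real_leI)
    qed
  qed
  then have "AE x in M \<Otimes>\<^sub>M \<mu>.
      (\<lambda>n. at_shift (- r n (snd x)) (V (fst x))) \<longlonglongrightarrow> at_shift (- snd x) (V (fst x))"
  proof eventually_elim
    fix x assume ev: "\<forall>\<^sub>F n in sequentially. x \<in> space (M \<Otimes>\<^sub>M \<mu>) - ?A n"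
    have "(\<lambda>n. (1/2 :: real) ^ n) \<longlonglongrightarrow> 0"
      by (rule LIMSEQ_power_zero) simp
    moreover have "\<forall>\<^sub>F n in sequentially.
        at_shift (- r n (snd x)) (V (fst x)) \<le> at_shift (- snd x) (V (fst x)) + ennreal ((1/2) ^ n) \<and>
        at_shift (- snd x) (V (fst x)) \<le> at_shift (- r n (snd x)) (V (fst x)) + ennreal ((1/2) ^ n)"
      using ev by eventually_elim blast
    ultimately show "(\<lambda>n. at_shift (- r n (snd x)) (V (fst x))) \<longlonglongrightarrow> at_shift (- snd x) (V (fst x))"
      by (intro ennreal_tendsto_if_close)
  qed
  from AE_pair[OF this] show ?thesis by simp
qed

text \<open>For both fields the measures of the deviations tend to \<open>0\<close>; at each level \<open>k\<close> one index therefore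
  makes both of them smaller than \<open>2\<^sup>-\<^sup>k\<close>. It is essential that one and the same sampling works for
  both fields, since the measurable versions built from it are to be inserted in the class identity.\<close>

lemma exists_common_sampling_real:
  assumes T: "T = UNIV" and V: "admissible T \<kappa> M V" and W: "admissible T \<kappa> N W"
  obtains r where "\<And>n. simple_function borel (r n)"
    "AE \<omega> in M. AE t in lborel. (\<lambda>n. at_shift (- r n t) (V \<omega>)) \<longlonglongrightarrow> at_shift (- t) (V \<omega>)"
    "AE \<omega> in N. AE t in lborel. (\<lambda>n. at_shift (- r n t) (W \<omega>)) \<longlonglongrightarrow> at_shift (- t) (W \<omega>)"
proof -
  obtain g :: "real ^ 'l \<Rightarrow> real" where g: "g \<in> borel_measurable lborel" "\<And>t. 0 < g t"
    "(\<integral>\<^sup>+t. ennreal (g t) \<partial>lborel) < \<infinity>"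
    using integrable_positive_weight[OF index_set] by (auto simp: T base_measure_def)
  define \<mu> where "\<mu> = density lborel (\<lambda>t. ennreal (g t))"
  have \<mu>: "sets \<mu> = sets borel" by (simp add: \<mu>_def)
  have fin: "finite_measure \<mu>"
    using g(1,3) by (intro finite_measureI) (simp add: \<mu>_def emeasure_density)
  have AE_\<mu>: "(AE t in \<mu>. P t) \<longleftrightarrow> (AE t in lborel. P t)" for P
    unfolding \<mu>_def using g(1,2) by (subst AE_density) simp_all
  obtain q :: "nat \<Rightarrow> real ^ 'l \<Rightarrow> real ^ 'l" where q: "\<And>n. simple_function borel (q n)"
    "\<And>t. (\<lambda>n. q n t) \<longlonglongrightarrow> t"
    using borel_measurable_implies_sequence_metric[of "\<lambda>t. t" borel 0] by auto
  let ?e = "\<lambda>K U k n. emeasure (K \<Otimes>\<^sub>M \<mu>) {x \<in> space (K \<Otimes>\<^sub>M \<mu>).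
     far ((1/2) ^ k) (at_shift (- q n (snd x)) (U (fst x))) (at_shift (- snd x) (U (fst x)))}"
  have "\<forall>k. \<exists>n. ?e M V k n \<le> ennreal ((1/2) ^ k) \<and> ?e N W k n \<le> ennreal ((1/2) ^ k)"
  proof
    fix k
    have pos: "0 < (1/2 :: real) ^ k" by simp
    have "\<forall>\<^sub>F n in sequentially. ?e M V k n < ennreal ((1/2) ^ k)"
      using deviation_tendsto_0[OF T V q \<mu> fin pos] by (rule order_tendstoD) simp
    moreover have "\<forall>\<^sub>F n in sequentially. ?e N W k n < ennreal ((1/2) ^ k)"
      using deviation_tendsto_0[OF T W q \<mu> fin pos] by (rule order_tendstoD) simp
    ultimately have "\<forall>\<^sub>F n in sequentially. ?e M V k n \<le> ennreal ((1/2) ^ k) \<and> ?e N W k n \<le> ennreal ((1/2) ^ k)"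
      by eventually_elim (simp add: less_imp_le)
    then show "\<exists>n. ?e M V k n \<le> ennreal ((1/2) ^ k) \<and> ?e N W k n \<le> ennreal ((1/2) ^ k)"
      by (rule eventually_happens'[OF sequentially_bot])
  qed
  from choice[OF this] obtain s
    where "\<forall>k. ?e M V k (s k) \<le> ennreal ((1/2) ^ k) \<and> ?e N W k (s k) \<le> ennreal ((1/2) ^ k)"
    by (rule exE)
  note s = this[rule_format, THEN conjunct1] this[rule_format, THEN conjunct2]
  show ?thesis
  proof (rule that[of "\<lambda>k. q (s k)"])
    show "simple_function borel (q (s k))" for k by (rule q(1))
    show "AE \<omega> in M. AE t in lborel. (\<lambda>n. at_shift (- q (s n) t) (V \<omega>)) \<longlonglongrightarrow> at_shift (- t) (V \<omega>)"
      using sampling_converges_AE[OF T V q(1) \<mu> fin s(1)] by (simp only: AE_\<mu>)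
    show "AE \<omega> in N. AE t in lborel. (\<lambda>n. at_shift (- q (s n) t) (W \<omega>)) \<longlonglongrightarrow> at_shift (- t) (W \<omega>)"
      using sampling_converges_AE[OF T W q(1) \<mu> fin s(2)] by (simp only: AE_\<mu>)
  qed
qed

lemma AE_sampled_pathsI:
  assumes adm: "admissible T \<kappa> M V"
    and lim: "AE \<omega> in M. AE t in base_measure T. (\<lambda>n. at_shift (- r n t) (V \<omega>)) \<longlonglongrightarrow> at_shift (- t) (V \<omega>)"
  shows "AE \<omega> in M. V \<omega> \<in> sampled_paths r"
  using lim AE_space[of M]
proof eventually_elim
  case (elim \<omega>)
  with measurable_trace[OF adm] measurable_space[OF admissibleD(3)[OF adm]] show ?case
    by (simp add: sampled_paths_def)
qed

text \<open>A discrete index set is countable, and there the identity already is a sampling.\<close>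

lemma exists_common_sampling:
  assumes V: "admissible T \<kappa> M V" and W: "admissible T \<kappa> N W"
  obtains r where "sampling r"
    "AE \<omega> in M. V \<omega> \<in> sampled_paths r" "AE \<omega> in N. W \<omega> \<in> sampled_paths r"
proof -
  show ?thesis
  proof (cases "T = UNIV")
    case True
    then have base: "base_measure T = lborel" by (simp add: base_measure_def)
    obtain r where r: "\<And>n. simple_function borel (r n)"
      "AE \<omega> in M. AE t in lborel. (\<lambda>n. at_shift (- r n t) (V \<omega>)) \<longlonglongrightarrow> at_shift (- t) (V \<omega>)"
      "AE \<omega> in N. AE t in lborel. (\<lambda>n. at_shift (- r n t) (W \<omega>)) \<longlonglongrightarrow> at_shift (- t) (W \<omega>)"
      using exists_common_sampling_real[OF True V W] by blast
    show ?thesis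
    proof (rule that[of r])
      have "r n t \<in> T" for n t
        by (simp add: True)
      moreover have "(\<lambda>(t, f). at_shift (- r n t) f) \<in> borel_measurable (base_measure T \<Otimes>\<^sub>M path_space T)" for n
        unfolding base by (rule measurable_sampled_shift[OF True r(1)])
      ultimately show "sampling r"
        unfolding sampling_def by blast
      show "AE \<omega> in M. V \<omega> \<in> sampled_paths r"
        by (rule AE_sampled_pathsI[OF V]) (use r(2) in \<open>simp only: base\<close>)
      show "AE \<omega> in N. W \<omega> \<in> sampled_paths r"
        by (rule AE_sampled_pathsI[OF W]) (use r(3) in \<open>simp only: base\<close>)
    qed
  next
    case False
    then have base: "base_measure T = count_space T" by (simp add: base_measure_def)
    have "countable T"
      using countable_rational_points[of T] discrete_index_set_rational[OF index_set False] by simp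
    show ?thesis
    proof (rule that[of "\<lambda>n t. t"])
      have "(\<lambda>x. at_shift (- fst x) (snd x)) \<in> borel_measurable (count_space T \<Otimes>\<^sub>M path_space T)"
      proof (rule measurable_compose_countable'[where I = T and g = fst
          and f = "\<lambda>s x. at_shift (- s) (snd x)"])
        show "(\<lambda>x. at_shift (- s) (snd x)) \<in> borel_measurable (count_space T \<Otimes>\<^sub>M path_space T)"
          if "s \<in> T" for s
          by (rule measurable_compose[OF measurable_snd measurable_at_shift])
            (rule index_set_uminus[OF index_set that])
      qed (simp_all add: \<open>countable T\<close>)
      then show "sampling (\<lambda>n t. t)"
        unfolding sampling_def base by (simp add: case_prod_beta')
      show "AE \<omega> in M. V \<omega> \<in> sampled_paths (\<lambda>n t. t)"
        by (rule AE_sampled_pathsI[OF V]) simp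
      show "AE \<omega> in N. W \<omega> \<in> sampled_paths (\<lambda>n t. t)"
        by (rule AE_sampled_pathsI[OF W]) simp
    qed
  qed
qed


section \<open>Path integrals as measurable functionals\<close>

lemma measurable_weight: "g \<in> weights T \<Longrightarrow> (\<lambda>t. ennreal (g t)) \<in> borel_measurable (index_measure T)"
  by (rule measurable_compose[OF _ measurable_ennreal]) (simp add: weights_def)

lemma measurable_kappa_integrand:
  assumes "f \<in> sampled_paths r" "g \<in> weights T"
  shows "kappa_integrand T \<kappa> \<xi> g f \<in> borel_measurable (index_measure T)"
proof -
  have "(\<lambda>t. at_shift (- t) f) \<in> borel_measurable (index_measure T)"
    using assms(1) by (intro measurable_index_measure) (simp add: sampled_paths_def)
  from borel_measurable_times_ennreal[OF measurable_epow[OF this] measurable_weight[OF assms(2)]]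
  show ?thesis by (simp add: kappa_integrand_def[abs_def])
qed

lemma kappa_integral_scale_path:
  assumes "f \<in> sampled_paths r" "g \<in> weights T" "0 < c"
  shows "kappa_integral T \<kappa> \<xi> g (scale_path T c f) =
    ennreal ((c powr \<alpha>) powr \<xi>) * kappa_integral T \<kappa> \<xi> g f"
proof -
  have "kappa_integral T \<kappa> \<xi> g (scale_path T c f) =
      (\<integral>\<^sup>+t. ennreal ((c powr \<alpha>) powr \<xi>) * kappa_integrand T \<kappa> \<xi> g f t \<partial>index_measure T)"
    unfolding kappa_integral_def
  proof (rule nn_integral_cong)
    fix t assume "t \<in> space (index_measure T)"
    then have "- t \<in> T"
      by (auto simp: index_measure_def intro: index_set_uminus[OF index_set] split: if_splits)
    then show "kappa_integrand T \<kappa> \<xi> g (scale_path T c f) t =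
        ennreal ((c powr \<alpha>) powr \<xi>) * kappa_integrand T \<kappa> \<xi> g f t"
      using assms(3) by (simp add: kappa_integrand_def at_shift_scale_path epow_mult mult.assoc)
  qed
  also have "\<dots> = ennreal ((c powr \<alpha>) powr \<xi>) * kappa_integral T \<kappa> \<xi> g f"
    unfolding kappa_integral_def
    by (rule nn_integral_cmult) (rule measurable_kappa_integrand[OF assms(1,2)])
  finally show ?thesis .
qed

text \<open>Along a sampled path, replacing the trace by the upper limit of its samples, and the weight by a
  Borel function, changes the integrand only on a null set of \<open>t\<close>, and makes it jointly measurable in \<open>(t, f)\<close>.\<close>

lemma kappa_integral_measurable_version:
  assumes r: "sampling r" and g: "g \<in> weights T"
  obtains J where "J \<in> borel_measurable (path_space T)"
    "\<And>f. f \<in> sampled_paths r \<Longrightarrow> kappa_integral T \<kappa> \<xi> g f = J f"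
proof -
  interpret sigma_finite_measure "base_measure T"
    by (rule sigma_finite_base_measure) (rule index_set)
  have "g \<in> borel_measurable (index_measure T)" using g by (simp add: weights_def)
  then obtain g' where g': "g' \<in> borel_measurable (base_measure T)" "AE t in base_measure T. g t = g' t"
    by (rule measurable_index_measure_version)
  define J where "J f = (\<integral>\<^sup>+t. epow (limsup (\<lambda>n. at_shift (- r n t) f)) \<xi> * ennreal (g' t) \<partial>base_measure T)" for f
  have "(\<lambda>x. at_shift (- r n (snd x)) (fst x)) \<in> borel_measurable (path_space T \<Otimes>\<^sub>M base_measure T)" for n
    using r measurable_compose[OF measurable_pair_swap', of "\<lambda>(t, f). at_shift (- r n t) f"]
    by (simp add: sampling_def case_prod_beta')
  then have "(\<lambda>x. limsup (\<lambda>n. at_shift (- r n (snd x)) (fst x))) \<in> borel_measurable (path_space T \<Otimes>\<^sub>M base_measure T)"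
    by (rule borel_measurable_limsup)
  then have "(\<lambda>x. epow (limsup (\<lambda>n. at_shift (- r n (snd x)) (fst x))) \<xi> * ennreal (g' (snd x)))
      \<in> borel_measurable (path_space T \<Otimes>\<^sub>M base_measure T)"
    by (intro borel_measurable_times_ennreal measurable_epow
        measurable_compose[OF measurable_compose[OF measurable_snd g'(1)] measurable_ennreal])
  then have "J \<in> borel_measurable (path_space T)"
    unfolding J_def[abs_def] by (intro borel_measurable_nn_integral) (simp add: case_prod_beta')
  moreover have "kappa_integral T \<kappa> \<xi> g f = J f" if "f \<in> sampled_paths r" for f
  proof -
    have "AE t in base_measure T. (\<lambda>n. at_shift (- r n t) f) \<longlonglongrightarrow> at_shift (- t) f"
      using that by (simp add: sampled_paths_def)
    then have "AE t in base_measure T. kappa_integrand T \<kappa> \<xi> g f t =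
        epow (limsup (\<lambda>n. at_shift (- r n t) f)) \<xi> * ennreal (g' t)"
      using g'(2)
    proof eventually_elim
      case (elim t)
      from lim_imp_Limsup[OF sequentially_bot elim(1)] elim(2) show ?case
        by (simp add: kappa_integrand_def)
    qed
    then show ?thesis
      unfolding kappa_integral_def nn_integral_index_measure J_def by (rule nn_integral_cong_AE)
  qed
  ultimately show ?thesis by (rule that)
qed

text \<open>The set \<open>A\<close> is arbitrary, so homogeneity of the whole quotient has to supply its
  measurability. If the exponent of the middle integral is \<open>0\<close>, that integral is a constant. Otherwise scaling a path
  moves the integral through all of \<open>(0,\<infinity>)\<close> as soon as it has one value there, while it
  keeps a nonzero quotient nonzero: then \<open>A\<close> contains \<open>(0,\<infinity>)\<close>. In the remaining case only
  \<open>A \<inter> {0, \<infinity>}\<close> matters.\<close>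

lemma quotient_borel_restriction:
  assumes hom: "homogeneous T \<beta> (kappa_quotient T \<kappa> \<Gamma> \<xi> g A)"
    and g: "g 2 \<in> weights T" and r: "sampling r"
  obtains B where "B \<in> sets borel"
    "\<And>f. f \<in> sampled_paths r \<Longrightarrow> kappa_quotient T \<kappa> \<Gamma> \<xi> g A f = kappa_quotient T \<kappa> \<Gamma> \<xi> g B f"
proof -
  let ?I = "\<lambda>f. kappa_integral T \<kappa> (\<xi> 2) (g 2) f"
  have cong: "kappa_quotient T \<kappa> \<Gamma> \<xi> g A f = kappa_quotient T \<kappa> \<Gamma> \<xi> g B f"
    if "?I f \<in> A \<longleftrightarrow> ?I f \<in> B" for B f
    using that by (simp add: kappa_quotient_def indicator_def)
  have zero: "kappa_quotient T \<kappa> \<Gamma> \<xi> g B f = 0" if "?I f \<notin> B" for B f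
    using that by (simp add: kappa_quotient_def indicator_def)
  show ?thesis
  proof (cases "\<xi> 2 = 0")
    case True
    then have const: "?I f = (\<integral>\<^sup>+t. ennreal (g 2 t) \<partial>index_measure T)" for f
      by (simp add: kappa_integral_def kappa_integrand_def epow_def)
    show ?thesis
      by (rule that[of "if (\<integral>\<^sup>+t. ennreal (g 2 t) \<partial>index_measure T) \<in> A then UNIV else {}"])
        (auto intro!: cong simp: const)
  next
    case False
    show ?thesis
    proof (cases "\<exists>f\<in>sampled_paths r. kappa_quotient T \<kappa> \<Gamma> \<xi> g A f \<noteq> 0 \<and> ?I f \<notin> {0, \<infinity>}")
      case True
      then obtain f where f: "f \<in> sampled_paths r" "kappa_quotient T \<kappa> \<Gamma> \<xi> g A f \<noteq> 0" "?I f \<notin> {0, \<infinity>}"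
        by blast
      then obtain x where x: "?I f = ennreal x" "0 < x"
        by (cases "?I f") (auto simp: less_le)
      have "y \<in> A" if "y \<notin> {0, \<infinity>}" for y
      proof -
        obtain z where z: "y = ennreal z" "0 < z"
          using \<open>y \<notin> {0, \<infinity>}\<close> by (cases y) (auto simp: less_le)
        \<comment> \<open>Scaling by \<open>c\<close> multiplies the integral by \<open>c powr (\<alpha> * \<xi> 2)\<close>, which has to be \<open>z / x\<close>.\<close>
        define c where "c = (z / x) powr (1 / (\<alpha> * \<xi> 2))"
        have c: "0 < c" using x(2) z(2) by (simp add: c_def)
        have "(c powr \<alpha>) powr \<xi> 2 = z / x"
          using x(2) z(2) alpha_pos False by (simp add: c_def powr_powr)
        then have "?I (scale_path T c f) = y"
          using kappa_integral_scale_path[OF f(1) g c] x z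
          by (simp add: ennreal_mult[symmetric])
        moreover have "kappa_quotient T \<kappa> \<Gamma> \<xi> g A (scale_path T c f) \<noteq> 0"
          using hom c f(1,2) by (simp add: homogeneous_def sampled_paths_def)
        ultimately show "y \<in> A" using zero by blast
      qed
      then have "- A \<subseteq> {0, \<infinity>}" by blast
      then have "finite (- A)" by (rule finite_subset) simp
      then have "A \<in> sets borel"
        using borel_comp[OF borel_closed[OF finite_imp_closed]] by fastforce
      then show ?thesis by (rule that) simp
    next
      case triv: False
      have "finite (A \<inter> {0, \<infinity>})" by simp
      then have "A \<inter> {0, \<infinity>} \<in> sets borel"
        by (intro borel_closed finite_imp_closed)
      then show ?thesis
      proof (rule that)
        fix f assume f: "f \<in> sampled_paths r"
        show "kappa_quotient T \<kappa> \<Gamma> \<xi> g A f = kappa_quotient T \<kappa> \<Gamma> \<xi> g (A \<inter> {0, \<infinity>}) f"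
        proof (cases "?I f \<in> {0, \<infinity>}")
          case True
          then show ?thesis by (intro cong) blast
        next
          case False
          with triv f have "kappa_quotient T \<kappa> \<Gamma> \<xi> g A f = 0" by blast
          with zero[of f "A \<inter> {0, \<infinity>}"] False show ?thesis by simp
        qed
      qed
    qed
  qed
qed

lemma integral_map_measurable_version:
  assumes F: "F \<in> integral_maps T \<kappa> \<beta>"
    and r: "sampling r"
  obtains F' where "F' \<in> borel_measurable (path_space T)" "\<And>f. f \<in> sampled_paths r \<Longrightarrow> F f = F' f"
proof -
  from F obtain \<Gamma> \<xi> g A where \<Gamma>: "\<Gamma> \<in> hom_maps T (\<xi> 0)" and g: "\<And>i. i \<in> {1..3::nat} \<Longrightarrow> g i \<in> weights T"
    and eq: "\<And>f. f \<in> space (path_space T) \<Longrightarrow> F f = kappa_quotient T \<kappa> \<Gamma> \<xi> g A f"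
    and hom: "homogeneous T \<beta> F"
    unfolding integral_maps_def by blast
  have hom': "homogeneous T \<beta> (kappa_quotient T \<kappa> \<Gamma> \<xi> g A)"
    using hom by (simp add: homogeneous_def eq scale_path_in_space)
  have g1: "g 1 \<in> weights T" and g2: "g 2 \<in> weights T" and g3: "g 3 \<in> weights T"
    by (simp_all add: g)
  obtain B where B: "B \<in> sets borel"
    "\<And>f. f \<in> sampled_paths r \<Longrightarrow> kappa_quotient T \<kappa> \<Gamma> \<xi> g A f = kappa_quotient T \<kappa> \<Gamma> \<xi> g B f"
    by (rule quotient_borel_restriction[OF hom' g2 r]) (rule that)
  obtain J1 where J1: "J1 \<in> borel_measurable (path_space T)"
    "\<And>f. f \<in> sampled_paths r \<Longrightarrow> kappa_integral T \<kappa> (\<xi> 1) (g 1) f = J1 f"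
    by (rule kappa_integral_measurable_version[OF r g1]) (rule that)
  obtain J2 where J2: "J2 \<in> borel_measurable (path_space T)"
    "\<And>f. f \<in> sampled_paths r \<Longrightarrow> kappa_integral T \<kappa> (\<xi> 2) (g 2) f = J2 f"
    by (rule kappa_integral_measurable_version[OF r g2]) (rule that)
  obtain J3 where J3: "J3 \<in> borel_measurable (path_space T)"
    "\<And>f. f \<in> sampled_paths r \<Longrightarrow> kappa_integral T \<kappa> (\<xi> 3) (g 3) f = J3 f"
    by (rule kappa_integral_measurable_version[OF r g3]) (rule that)
  have [measurable]: "J1 \<in> borel_measurable (path_space T)" "J2 \<in> borel_measurable (path_space T)"
    "J3 \<in> borel_measurable (path_space T)" "\<Gamma> \<in> borel_measurable (path_space T)" "B \<in> sets borel"
    using J1 J2 J3 \<Gamma> B by (simp_all add: hom_maps_def meas_maps_def)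
  define F' where "F' f = (if J3 f \<noteq> 0 then \<Gamma> f * enn2ereal (J1 f) * indicator B (J2 f) / enn2ereal (J3 f) else 0)" for f
  have "F' \<in> borel_measurable (path_space T)"
    unfolding F'_def[abs_def] by measurable
  moreover have "F f = F' f" if f: "f \<in> sampled_paths r" for f
  proof -
    have "F f = kappa_quotient T \<kappa> \<Gamma> \<xi> g B f"
      using f B(2) eq by (simp add: sampled_paths_def)
    also have "\<dots> = F' f"
      using measurable_kappa_integrand[OF f g]
      by (simp add: kappa_quotient_def F'_def J1(2)[OF f, simplified] J2(2)[OF f] J3(2)[OF f])
    finally show ?thesis .
  qed
  ultimately show ?thesis by (rule that)
qed

text \<open>The factor \<open>k\<close> allows for both degrees: it is \<open>\<kappa> \<circ> B\<^sup>h\<close> when \<open>F\<close> has degree \<open>0\<close>, and the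
  constant \<open>1\<close> when \<open>F\<close> has degree \<open>\<alpha>\<close>.\<close>

lemma class_identity_imp_same_expectation:
  assumes V: "admissible T \<kappa> M V" and W: "admissible T \<kappa> N W"
    and cls: "class_identity T \<alpha> \<kappa> M V N W"
    and F: "F \<in> integral_maps T \<kappa> \<beta>"
    and k: "k \<in> borel_measurable (path_space T)" and H: "homogeneous T \<alpha> (\<lambda>f. k f * F f)"
  shows "same_expectation M (\<lambda>\<omega>. k (V \<omega>) * F (V \<omega>)) N (\<lambda>\<omega>. k (W \<omega>) * F (W \<omega>))"
proof -
  obtain r where r: "sampling r"
    "AE \<omega> in M. V \<omega> \<in> sampled_paths r" "AE \<omega> in N. W \<omega> \<in> sampled_paths r"
    by (rule exists_common_sampling[OF V W]) (rule that)
  obtain F' where F': "F' \<in> borel_measurable (path_space T)" "\<And>f. f \<in> sampled_paths r \<Longrightarrow> F f = F' f"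
    by (rule integral_map_measurable_version[OF F r(1)]) (rule that)
  have sub: "sampled_paths r \<subseteq> space (path_space T)"
    by (auto simp: sampled_paths_def)
  show ?thesis
  proof (rule class_identity_homogeneous_same_expectation[OF V W cls r(2,3) sub _ H])
    show "(\<lambda>f. k f * F' f) \<in> borel_measurable (path_space T)"
      by (intro borel_measurable_ereal_times k F'(1))
  qed (simp_all add: F'(2) scale_path_sampled_paths[OF r(1)])
qed

section \<open>Homogeneous extensions as test maps\<close>

text \<open>With exponents \<open>\<xi>\<^sub>1 = \<xi>\<^sub>2 = \<xi>\<^sub>3 = 0\<close> the path integrals are constants; taking \<open>g\<^sub>1 = g\<^sub>3\<close> they cancel,
  and \<open>A = UNIV\<close> leaves the factor \<open>\<Gamma>\<close>.\<close>

lemma hom_maps_subset_integral_maps: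
  assumes "0 \<le> \<beta>" "\<Gamma> \<in> hom_maps T \<beta>"
  shows "\<Gamma> \<in> integral_maps T \<kappa> \<beta>"
proof -
  obtain g where g: "g \<in> weights T" "0 < (\<integral>\<^sup>+t. ennreal (g t) \<partial>base_measure T)"
    "(\<integral>\<^sup>+t. ennreal (g t) \<partial>base_measure T) < \<infinity>"
    using integrable_positive_weight[OF index_set] by blast
  define \<xi> where "\<xi> = (\<lambda>i::nat. if i = 0 then \<beta> else 0)"
  have integrand: "kappa_integrand T \<kappa> 0 g f = (\<lambda>t. ennreal (g t))" for f
    by (simp add: kappa_integrand_def[abs_def] epow_def)
  obtain x where x: "(\<integral>\<^sup>+t. ennreal (g t) \<partial>base_measure T) = ennreal x" "0 < x"
    using g(2,3) by (cases "\<integral>\<^sup>+t. ennreal (g t) \<partial>base_measure T") auto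
  have integral: "kappa_integral T \<kappa> 0 g f = ennreal x" for f
    by (simp add: kappa_integral_def integrand nn_integral_index_measure x(1))
  have "\<Gamma> f = kappa_quotient T \<kappa> \<Gamma> \<xi> (\<lambda>_. g) UNIV f" for f
    using x(2) by (cases "\<Gamma> f")
      (simp_all add: kappa_quotient_def \<xi>_def integral integrand measurable_weight[OF g(1)])
  moreover have "homogeneous T \<beta> \<Gamma>" using assms(2) by (simp add: hom_maps_def)
  moreover have "0 \<le> \<xi> 0" "\<Gamma> \<in> hom_maps T (\<xi> 0)" using assms by (simp_all add: \<xi>_def)
  ultimately show ?thesis
    unfolding integral_maps_def using g(1)
    by (intro CollectI conjI exI[of _ \<Gamma>] exI[of _ \<xi>] exI[of _ "\<lambda>_. g"] exI[of _ UNIV]) simp_all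
qed

text \<open>A \<open>0\<close>-homogeneous map that agrees with \<open>F\<close> on the paths with \<open>\<kappa> (B\<^sup>h f) = 1\<close>. It is set to \<open>0\<close>
  where \<open>\<kappa> (B\<^sup>h f) = \<infinity>\<close> in order that real-valued \<open>F\<close> lead to real-valued maps even after
  multiplication with \<open>\<kappa> (B\<^sup>h f)\<close>.\<close>

definition hom_extension :: "real ^ 'l \<Rightarrow> (('l, 'd) path \<Rightarrow> ereal) \<Rightarrow> ('l, 'd) path \<Rightarrow> ereal" where
  "hom_extension h F f =
     (if at_shift h f = 0 \<or> at_shift h f = \<infinity> then 0 else F (normalize_path T \<alpha> (at_shift h f) f))"

lemma measurable_hom_extension:
  assumes F: "F \<in> borel_measurable (path_space T)" and h: "h \<in> T"
  shows "hom_extension h F \<in> borel_measurable (path_space T)"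
proof -
  note k [measurable] = measurable_at_shift[OF h]
  have [measurable]: "(\<lambda>f. F (normalize_path T \<alpha> (at_shift h f) f)) \<in> borel_measurable (path_space T)"
    by (rule measurable_compose[OF measurable_normalize_path[OF k] F])
  show ?thesis unfolding hom_extension_def[abs_def] by measurable
qed

lemma hom_extension_scale_path:
  assumes h: "h \<in> T" and c: "0 < c"
  shows "hom_extension h F (scale_path T c f) = hom_extension h F f"
proof (cases "at_shift h f = 0 \<or> at_shift h f = \<infinity>")
  case True
  with h c show ?thesis
    by (auto simp: hom_extension_def at_shift_scale_path ennreal_mult_eq_top_iff)
next
  case False
  then obtain k where k: "at_shift h f = ennreal k" "0 < k"
    by (cases "at_shift h f") (auto simp: less_le)
  have scaled: "at_shift h (scale_path T c f) = ennreal (c powr \<alpha> * k)"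
    using h c k by (simp add: at_shift_scale_path ennreal_mult)
  have "(c powr \<alpha> * k) powr (1 / \<alpha>) = c * k powr (1 / \<alpha>)"
    using c k(2) alpha_pos by (simp add: powr_mult powr_powr)
  then have "inverse ((c powr \<alpha> * k) powr (1 / \<alpha>)) * c = inverse (k powr (1 / \<alpha>))"
    using c by simp
  then show ?thesis
    using c k by (simp add: hom_extension_def scaled k(1) normalize_path_def scale_path_scale_path)
qed

lemma hom_extension_in_hom_maps:
  assumes F: "F \<in> meas_maps T" and h: "h \<in> T"
  shows "hom_extension h F \<in> hom_maps T 0"
    and "(\<lambda>f. enn2ereal (at_shift h f) * hom_extension h F f) \<in> hom_maps T \<alpha>"
proof -
  have F_meas: "F \<in> borel_measurable (path_space T)"
    using F by (simp add: meas_maps_def)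
  note \<Gamma> = measurable_hom_extension[OF F_meas h]
  have k\<Gamma>: "(\<lambda>f. enn2ereal (at_shift h f) * hom_extension h F f) \<in> borel_measurable (path_space T)"
    by (intro borel_measurable_ereal_times \<Gamma> measurable_compose[OF measurable_at_shift[OF h]]) measurable
  have norm: "normalize_path T \<alpha> k f \<in> space (path_space T)" for k and f :: "('l, 'd) path"
    by (simp add: normalize_path_def scale_path_in_space)
  have fin: "(\<bar>hom_extension h F f\<bar> \<noteq> \<infinity>) \<and> \<bar>enn2ereal (at_shift h f) * hom_extension h F f\<bar> \<noteq> \<infinity>"
    if "\<forall>f\<in>space (path_space T). \<bar>F f\<bar> \<noteq> \<infinity>" for f
  proof -
    have "\<bar>F (normalize_path T \<alpha> (at_shift h f) f)\<bar> \<noteq> \<infinity>"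
      by (rule bspec[OF that norm])
    then show ?thesis
      by (cases "at_shift h f"; cases "F (normalize_path T \<alpha> (at_shift h f) f)")
        (auto simp: hom_extension_def zero_ennreal.rep_eq)
  qed
  have nonneg': "0 \<le> hom_extension h F f \<and> 0 \<le> enn2ereal (at_shift h f) * hom_extension h F f"
    if "\<forall>f\<in>space (path_space T). 0 \<le> F f" for f
    using that norm by (simp add: hom_extension_def)
  consider (finite) "\<forall>f\<in>space (path_space T). \<bar>F f\<bar> \<noteq> \<infinity>" | (nonneg) "\<forall>f\<in>space (path_space T). 0 \<le> F f"
    using F by (auto simp: meas_maps_def)
  then have meas: "hom_extension h F \<in> meas_maps T \<and>
      (\<lambda>f. enn2ereal (at_shift h f) * hom_extension h F f) \<in> meas_maps T"
  proof cases
    case finite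
    from fin[OF this] \<Gamma> k\<Gamma> show ?thesis by (simp add: meas_maps_def)
  next
    case nonneg
    from nonneg'[OF this] \<Gamma> k\<Gamma> show ?thesis by (simp add: meas_maps_def)
  qed
  show "hom_extension h F \<in> hom_maps T 0"
    using meas by (simp add: hom_maps_def homogeneous_def hom_extension_scale_path[OF h] flip: one_ereal_def)
  have "homogeneous T \<alpha> (\<lambda>f. enn2ereal (at_shift h f) * hom_extension h F f)"
    using h by (simp add: homogeneous_def hom_extension_scale_path at_shift_scale_path
        times_ennreal.rep_eq mult.assoc)
  with meas show "(\<lambda>f. enn2ereal (at_shift h f) * hom_extension h F f) \<in> hom_maps T \<alpha>"
    by (simp add: hom_maps_def)
qed

text \<open>Almost surely \<open>\<kappa> (B\<^sup>h V)\<close> is finite, and where it is \<open>0\<close> the product vanishes anyway; so replacing \<open>F\<close>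
  of the normalised path by its homogeneous extension does not change the products almost surely.\<close>

lemma class_identityI_hom_extension:
  assumes V: "admissible T \<kappa> M V" and W: "admissible T \<kappa> N W"
    and same: "\<And>F h. F \<in> meas_maps T \<Longrightarrow> h \<in> T \<Longrightarrow>
      same_expectation M (\<lambda>\<omega>. enn2ereal (at_shift h (V \<omega>)) * hom_extension h F (V \<omega>))
                       N (\<lambda>\<omega>. enn2ereal (at_shift h (W \<omega>)) * hom_extension h F (W \<omega>))"
  shows "class_identity T \<alpha> \<kappa> M V N W"
  unfolding class_identity_def Let_def
proof (intro ballI)
  fix F :: "('l, 'd) path \<Rightarrow> ereal" and h assume F: "F \<in> meas_maps T" and "h \<in> T"
  then have h: "- h \<in> T" by (simp add: index_set_uminus[OF index_set])
  let ?X = "\<lambda>f. enn2ereal (at_shift (- h) f) * hom_extension (- h) F f"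
  let ?Y = "\<lambda>f. enn2ereal (at_shift (- h) f) * F (normalize_path T \<alpha> (at_shift (- h) f) f)"
  have X: "?X \<in> borel_measurable (path_space T)"
    using hom_extension_in_hom_maps(2)[OF F h] by (simp add: hom_maps_def meas_maps_def)
  have F_meas: "F \<in> borel_measurable (path_space T)"
    using F by (simp add: meas_maps_def)
  have Y: "?Y \<in> borel_measurable (path_space T)"
    by (intro borel_measurable_ereal_times measurable_compose[OF measurable_normalize_path F_meas]
        measurable_at_shift[OF h] measurable_compose[OF measurable_at_shift[OF h]]) measurable
  have eq: "?X f = ?Y f" if "\<forall>t\<in>T. at_shift t f < \<infinity>" for f
    using that h by (auto simp: hom_extension_def zero_ennreal.rep_eq)
  have "same_expectation M (\<lambda>\<omega>. ?Y (V \<omega>)) N (\<lambda>\<omega>. ?Y (W \<omega>))"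
  proof (rule same_expectation_cong_AE[OF _ _ _ _ _ _ same[OF F h]])
    show "AE \<omega> in M. ?X (V \<omega>) = ?Y (V \<omega>)"
      using admissible_AE_finite[OF V] by eventually_elim (rule eq)
    show "AE \<omega> in N. ?X (W \<omega>) = ?Y (W \<omega>)"
      using admissible_AE_finite[OF W] by eventually_elim (rule eq)
  qed (rule measurable_compose[OF admissibleD(3)[OF V]] measurable_compose[OF admissibleD(3)[OF W]], rule X Y)+
  then show "same_expectation N (\<lambda>\<omega>. ?Y (W \<omega>)) M (\<lambda>\<omega>. ?Y (V \<omega>))"
    by (rule same_expectation_sym)
qed

end

section \<open>The three characterisations of the class\<close>

theorem theorem3p3:
  fixes T :: "(real ^ 'l) set"
    and \<alpha> :: real
    and \<kappa> :: "(real ^ 'l \<Rightarrow> real ^ 'd) \<Rightarrow> ennreal"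
    and M :: "'w measure" and Z :: "'w \<Rightarrow> real ^ 'l \<Rightarrow> real ^ 'd"
    and N :: "'v measure" and Z' :: "'v \<Rightarrow> real ^ 'l \<Rightarrow> real ^ 'd"
  assumes "index_set T" and "\<alpha> > 0"
    and "(\<lambda>f. enn2ereal (\<kappa> f)) \<in> hom_maps T \<alpha>"
    and "admissible T \<kappa> M Z" and "admissible T \<kappa> N Z'"
  shows "(class_identity T \<alpha> \<kappa> M Z N Z' \<longleftrightarrow>
      (\<forall>F\<in>integral_maps T \<kappa> 0. \<forall>h\<in>T.
        same_expectation
          M (\<lambda>\<omega>. enn2ereal (\<kappa> (backshift T h (Z \<omega>))) * F (Z \<omega>))
          N (\<lambda>\<omega>. enn2ereal (\<kappa> (backshift T h (Z' \<omega>))) * F (Z' \<omega>)))) \<and>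
    (class_identity T \<alpha> \<kappa> M Z N Z' \<longleftrightarrow>
      (\<forall>F\<in>integral_maps T \<kappa> \<alpha>.
        same_expectation M (\<lambda>\<omega>. F (Z \<omega>)) N (\<lambda>\<omega>. F (Z' \<omega>))))"
proof -
  interpret homogeneous_functional T \<alpha> \<kappa>
    by unfold_locales (fact assms)+
  note V = assms(4) and W = assms(5)
  show ?thesis
  proof (intro conjI iffI ballI)
    fix F :: "(real ^ 'l \<Rightarrow> real ^ 'd) \<Rightarrow> ereal" and h
    assume cls: "class_identity T \<alpha> \<kappa> M Z N Z'" and F: "F \<in> integral_maps T \<kappa> 0" and h: "h \<in> T"
    have "homogeneous T \<alpha> (\<lambda>f. enn2ereal (at_shift h f) * F f)"
      using F h by (simp add: homogeneous_def integral_maps_def at_shift_scale_path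
          times_ennreal.rep_eq mult.assoc)
    then show "same_expectation M (\<lambda>\<omega>. enn2ereal (at_shift h (Z \<omega>)) * F (Z \<omega>))
        N (\<lambda>\<omega>. enn2ereal (at_shift h (Z' \<omega>)) * F (Z' \<omega>))"
      by (rule class_identity_imp_same_expectation[OF V W cls F
            measurable_compose[OF measurable_at_shift[OF h] measurable_enn2ereal]])
  next
    assume b: "\<forall>F\<in>integral_maps T \<kappa> 0. \<forall>h\<in>T.
        same_expectation M (\<lambda>\<omega>. enn2ereal (at_shift h (Z \<omega>)) * F (Z \<omega>))
          N (\<lambda>\<omega>. enn2ereal (at_shift h (Z' \<omega>)) * F (Z' \<omega>))"
    show "class_identity T \<alpha> \<kappa> M Z N Z'"
      by (rule class_identityI_hom_extension[OF V W])
        (use b hom_maps_subset_integral_maps hom_extension_in_hom_maps(1) in blast)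
  next
    fix F :: "(real ^ 'l \<Rightarrow> real ^ 'd) \<Rightarrow> ereal"
    assume cls: "class_identity T \<alpha> \<kappa> M Z N Z'" and F: "F \<in> integral_maps T \<kappa> \<alpha>"
    have "homogeneous T \<alpha> (\<lambda>f. 1 * F f)"
      using F by (simp add: integral_maps_def)
    from class_identity_imp_same_expectation[OF V W cls F borel_measurable_const this]
    show "same_expectation M (\<lambda>\<omega>. F (Z \<omega>)) N (\<lambda>\<omega>. F (Z' \<omega>))" by simp
  next
    assume c: "\<forall>F\<in>integral_maps T \<kappa> \<alpha>. same_expectation M (\<lambda>\<omega>. F (Z \<omega>)) N (\<lambda>\<omega>. F (Z' \<omega>))"
    show "class_identity T \<alpha> \<kappa> M Z N Z'"
    proof (rule class_identityI_hom_extension[OF V W])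
      fix F :: "(real ^ 'l \<Rightarrow> real ^ 'd) \<Rightarrow> ereal" and h assume "F \<in> meas_maps T" "h \<in> T"
      from hom_maps_subset_integral_maps[OF less_imp_le[OF alpha_pos] hom_extension_in_hom_maps(2)[OF this]]
      show "same_expectation M (\<lambda>\<omega>. enn2ereal (at_shift h (Z \<omega>)) * hom_extension h F (Z \<omega>))
          N (\<lambda>\<omega>. enn2ereal (at_shift h (Z' \<omega>)) * hom_extension h F (Z' \<omega>))"
        by (rule c[rule_format])
    qed
  qed
qed

end
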